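(* Let $H_1,H_2\in(0,\tfrac12)\cup(\tfrac12,1)$, $H=H_1+H_2$, and let $Y=(Y^1,Y^2)$ be the bivariate fractional Ornstein–Uhlenbeck process with parameters $\alpha_1,\alpha_2,\nu_1,\nu_2>0$, $\rho$, $\eta_{12}=-\eta_{21}$. Let $N\in\mathbb N$, $t\in\mathbb R$ fixed and $i,j\in\{1,2\}$, $i\ne j$. If $H\ne1$ then, as $s\to\infty$, $$\mathrm{Cov}(Y^i_t,Y^j_{t+s})=\frac{\nu_1\nu_2(\rho+\eta_{ji})}{2(\alpha_1+\alpha_2)}\sum_{n=0}^N\Big(\frac{(-1)^n}{\alpha_j^{n+1}}+\frac1{\alpha_i^{n+1}}\Big)\Big(\prod_{k=0}^{n+1}(H-k)\Big)s^{H-2-n}+O(s^{H-N-3}).$$ If $H=1$ then, as $s\to\infty$, $$\mathrm{Cov}(Y^i_t,Y^j_{t+s})=\frac{\nu_1\nu_2\eta_{ji}}{2\alpha_1\alpha_2}\frac1s+\frac{\nu_1\nu_2\eta_{ji}}{2(\alpha_1+\alpha_2)}\sum_{n=1}^N\Big(\frac{(-1)^n}{\alpha_j^{n+1}}+\frac1{\alpha_i^{n+1}}\Big)\Big(\prod_{k=0}^{n-1}(-k-1)\Big)s^{-1-n}+O(s^{-N-2}).$$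
   Context: Bivariate fractional Brownian motion. $(B^{H_1}_t,B^{H_2}_t)_{t\in\mathbb R}$ is a centered Gaussian process such that each $B^{H_i}$ is a fractional Brownian motion on $\mathbb R$ with Hurst index $H_i\in(0,1)$ and $\mathrm{Var}(B^{H_i}_1)=1$, i.e. $\mathbb E[B^{H_i}_tB^{H_i}_s]=\frac12(|t|^{2H_i}+|s|^{2H_i}-|t-s|^{2H_i})$, and for $i\ne j$, with $H=H_1+H_2$: if $H\ne1$, $$\mathbb E[B^{H_i}_tB^{H_j}_s]=\tfrac12\big((\rho+\mathrm{sign}(t)\eta_{ij})|t|^H+(\rho-\mathrm{sign}(s)\eta_{ij})|s|^H-(\rho-\mathrm{sign}(s-t)\eta_{ij})|s-t|^H\big);$$ if $H=1$, $$\mathbb E[B^{H_i}_tB^{H_j}_s]=\tfrac12\big(\rho(|s|+|t|-|s-t|)+\eta_{ij}(s\log|s|-t\log|t|-(s-t)\log|s-t|)\big).$$ Here $\mathrm{sign}(x)=1$ for $x\ge0$ and $-1$ for $x<0$; $\rho\in[-1,1]$ and $\eta_{12}=-\eta_{21}\in\mathbb R$ are such that these formulas define a valid covariance. Bivariate fractional Ornstein–Uhlenbeck process: for $i=1,2$, $Y^i_t=\nu_i\int_{-\infty}^te^{-\alpha_i(t-s)}dB^{H_i}_s$, $t\in\mathbb R$ (pathwise Riemann–Stieltjes integral, equal to $\nu_i(B^{H_i}_t-\alpha_i\int_{-\infty}^te^{-\alpha_i(t-u)}B^{H_i}_udu)$). Convention for $O$: $f=O(g)$ as $s\to\infty$ means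 $\lim_{s\to\infty}f(s)/g(s)=C$ with $C$ a positive constant.
   Formalization: For H=1 the factor η_ji is corrected to η_ij (the printed sign contradicts the given covariance); O means the remainder ratio tends to a finite constant, nonzero except when ρ+η_ji=0 (resp. η_ij=0) or when α_i=α_j with N even, rather than to a positive constant. *)

theory Defs
  imports "HOL-Probability.Probability"
begin

definition covariance :: "'a measure \<Rightarrow> ('a \<Rightarrow> real) \<Rightarrow> ('a \<Rightarrow> real) \<Rightarrow> real" where
  "covariance M X Y =
     (\<integral>\<omega>. (X \<omega> - (\<integral>\<omega>'. X \<omega>' \<partial>M)) * (Y \<omega> - (\<integral>\<omega>'. Y \<omega>' \<partial>M)) \<partial>M)"

(* Finite linear combinations are normal; a degenerate (zero) combination has no density
   and is treated separately. *)
definition centered_gaussian_process :: "'a measure \<Rightarrow> 'k set \<Rightarrow> ('k \<Rightarrow> 'a \<Rightarrow> real) \<Rightarrow> bool" where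
  "centered_gaussian_process M I X \<longleftrightarrow>
     (\<forall>k\<in>I. X k \<in> borel_measurable M) \<and>
     (\<forall>F c. finite F \<and> F \<subseteq> I \<longrightarrow>
        (AE \<omega> in M. (\<Sum>k\<in>F. c k * X k \<omega>) = 0) \<or>
        (\<exists>\<sigma>>0. distributed M lborel (\<lambda>\<omega>. \<Sum>k\<in>F. c k * X k \<omega>) (\<lambda>x. ennreal (normal_density 0 \<sigma> x))))"

(* Differs from the library's sgn at 0. *)
definition sign1 :: "real \<Rightarrow> real" where
  "sign1 x = (if x \<ge> 0 then 1 else - 1)"

definition fbm_cov :: "real \<Rightarrow> real \<Rightarrow> real \<Rightarrow> real" where
  "fbm_cov H t s = (\<bar>t\<bar> powr (2 * H) + \<bar>s\<bar> powr (2 * H) - \<bar>t - s\<bar> powr (2 * H)) / 2"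

(* h is the sum of the two Hurst indices, e is the parameter eta of the ordered pair of
   components evaluated at t and s; note 0 * ln 0 = 0. *)
definition fbm_cross_cov :: "real \<Rightarrow> real \<Rightarrow> real \<Rightarrow> real \<Rightarrow> real \<Rightarrow> real" where
  "fbm_cross_cov h \<rho> e t s =
     (if h \<noteq> 1 then
        ((\<rho> + sign1 t * e) * \<bar>t\<bar> powr h + (\<rho> - sign1 s * e) * \<bar>s\<bar> powr h
           - (\<rho> - sign1 (s - t) * e) * \<bar>s - t\<bar> powr h) / 2
      else
        (\<rho> * (\<bar>s\<bar> + \<bar>t\<bar> - \<bar>s - t\<bar>)
           + e * (s * ln \<bar>s\<bar> - t * ln \<bar>t\<bar> - (s - t) * ln \<bar>s - t\<bar>)) / 2)"

(* The components are indexed by 1 and 2. That the parameters define a valid covariance is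
   implied by the existence of the process. *)
definition bivariate_fbm ::
  "'a measure \<Rightarrow> (nat \<Rightarrow> real) \<Rightarrow> real \<Rightarrow> (nat \<Rightarrow> nat \<Rightarrow> real) \<Rightarrow> (nat \<Rightarrow> real \<Rightarrow> 'a \<Rightarrow> real) \<Rightarrow> bool" where
  "bivariate_fbm M H \<rho> \<eta> B \<longleftrightarrow>
     (\<forall>i\<in>{1,2}. 0 < H i \<and> H i < 1) \<and> - 1 \<le> \<rho> \<and> \<rho> \<le> 1 \<and> \<eta> 1 2 = - \<eta> 2 1 \<and>
     centered_gaussian_process M ({1,2} \<times> UNIV) (\<lambda>(i, t). B i t) \<and>
     (\<forall>i\<in>{1,2}. \<forall>t s. (\<integral>\<omega>. B i t \<omega> * B i s \<omega> \<partial>M) = fbm_cov (H i) t s) \<and>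
     (\<forall>i\<in>{1,2}. \<forall>j\<in>{1,2}. i \<noteq> j \<longrightarrow>
        (\<forall>t s. (\<integral>\<omega>. B i t \<omega> * B j s \<omega> \<partial>M) = fbm_cross_cov (H 1 + H 2) \<rho> (\<eta> i j) t s))"

(* The Riemann--Stieltjes integral of f with respect to g over [a,b], as the limit of tagged
   sums when the mesh tends to 0. *)
definition has_RS_integral ::
  "(real \<Rightarrow> real) \<Rightarrow> (real \<Rightarrow> real) \<Rightarrow> real \<Rightarrow> real \<Rightarrow> real \<Rightarrow> bool" where
  "has_RS_integral f g a b I \<longleftrightarrow> a \<le> b \<and>
     (\<forall>\<epsilon>>0. \<exists>\<delta>>0. \<forall>(n::nat) (x::nat \<Rightarrow> real) (\<xi>::nat \<Rightarrow> real).
        x 0 = a \<and> x n = b \<and>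
        (\<forall>k<n. x k \<le> \<xi> k \<and> \<xi> k \<le> x (Suc k) \<and> x (Suc k) - x k < \<delta>) \<longrightarrow>
        \<bar>(\<Sum>k<n. f (\<xi> k) * (g (x (Suc k)) - g (x k))) - I\<bar> < \<epsilon>)"

definition has_RS_integral_from_minus_infinity ::
  "(real \<Rightarrow> real) \<Rightarrow> (real \<Rightarrow> real) \<Rightarrow> real \<Rightarrow> real \<Rightarrow> bool" where
  "has_RS_integral_from_minus_infinity f g b I \<longleftrightarrow>
     (\<exists>J. (\<forall>a\<le>b. has_RS_integral f g a b (J a)) \<and> (J \<longlongrightarrow> I) at_bot)"

definition bivariate_fOU ::
  "'a measure \<Rightarrow> (nat \<Rightarrow> real) \<Rightarrow> (nat \<Rightarrow> real) \<Rightarrow> (nat \<Rightarrow> real \<Rightarrow> 'a \<Rightarrow> real)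
     \<Rightarrow> (nat \<Rightarrow> real \<Rightarrow> 'a \<Rightarrow> real) \<Rightarrow> bool" where
  "bivariate_fOU M \<alpha> \<nu> B Y \<longleftrightarrow>
     (\<forall>i\<in>{1,2}. \<forall>t. Y i t \<in> borel_measurable M) \<and>
     (AE \<omega> in M. \<forall>i\<in>{1,2}. \<forall>t. \<exists>I.
        has_RS_integral_from_minus_infinity (\<lambda>s. exp (- \<alpha> i * (t - s))) (\<lambda>s. B i s \<omega>) t I \<and>
        Y i t \<omega> = \<nu> i * I)"

end

theory Submission
  imports Defs "HOL-Real_Asymp.Real_Asymp"
begin

text \<open>The cross covariance of the two fractional Brownian motions has the form
  \<open>A u + D v - G (v - u)\<close>. Integrating the exponential kernels against it annihilates the
  constants and leaves
  \<open>Cov(Y\<^sup>i\<^sub>t, Y\<^sup>j\<^sub>t\<^sub>+\<^sub>s) = \<nu>\<^sub>i \<nu>\<^sub>j (\<alpha>\<^sub>i\<^sup>2 P s + \<alpha>\<^sub>j\<^sup>2 Q s) / (\<alpha>\<^sub>i + \<alpha>\<^sub>j) - \<nu>\<^sub>i \<nu>\<^sub>j G s\<close>, where \<open>P\<close> and \<open>Q\<close> are the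
  forward and backward exponential averages of \<open>G\<close>, that is, the solutions of polynomial growth of
  \<open>P' = \<alpha>\<^sub>i P - G\<close> and \<open>Q' = G - \<alpha>\<^sub>j Q\<close>. Expanding \<open>P\<close> and \<open>Q\<close> formally in derivatives of \<open>G\<close>,
  the terms of order 0 and 1 cancel, and l'Hopital's rule for the remainders, which satisfy the same
  differential equations with a pure power as inhomogeneity, gives the exact order of the error.
  The passage from the pathwise integrals to covariances uses that almost sure limits of
  jointly Gaussian variables are limits in \<open>L\<^sup>2\<close>; no joint measurability or path continuity is needed.\<close>

section \<open>Exponential averages of functions of quadratic growth\<close>

text \<open>The process is given path by path, and nothing is assumed that would justify Fubini.
  Instead a fixed square integrable Z is paired with one pathwise integral: the moments of Z with
  its Riemann-Stieltjes sums are Riemann-Stieltjes sums of the deterministic continuous function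
  \<phi> u = E[Z B_u], and integration by parts turns their limit into \<phi> b - \<alpha> V b,
  where V' = \<phi> - \<alpha> V. This is applied twice: with Z a value of the other Brownian
  motion, and then with Z the Ornstein-Uhlenbeck variable just treated. Each pathwise integral is an
  iterated limit, in the mesh and then in the lower end, so L2 convergence is needed at both stages
  and the class of admissible variables must be closed under almost sure limits. No improper
  integral is formed: any solution V of quadratic growth will do, because the exponential kills its
  boundary term at minus infinity. Quadratic growth covers both kernels, |x|^H with H < 2 and x log
  |x|, and is kept by reflection, translation and exponential averaging.\<close>

definition quad_bounded :: "(real \<Rightarrow> real) \<Rightarrow> bool" where
  "quad_bounded \<phi> \<longleftrightarrow> (\<exists>K. \<forall>x. \<bar>\<phi> x\<bar> \<le> K * (1 + x\<^sup>2))"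

lemma quad_bounded_add:
  assumes "quad_bounded f" "quad_bounded g"
  shows "quad_bounded (\<lambda>x. f x + g x)"
proof -
  obtain K L where "\<And>x. \<bar>f x\<bar> \<le> K * (1 + x\<^sup>2)" "\<And>x. \<bar>g x\<bar> \<le> L * (1 + x\<^sup>2)"
    using assms unfolding quad_bounded_def by blast
  then have "\<bar>f x + g x\<bar> \<le> (K + L) * (1 + x\<^sup>2)" for x
    by (smt (verit, best) distrib_right)
  then show ?thesis unfolding quad_bounded_def by blast
qed

lemma quad_bounded_mult_const:
  assumes "quad_bounded f"
  shows "quad_bounded (\<lambda>x. c * f x)"
proof -
  obtain K where "\<And>x. \<bar>f x\<bar> \<le> K * (1 + x\<^sup>2)"
    using assms unfolding quad_bounded_def by blast
  then have "\<bar>c * f x\<bar> \<le> (\<bar>c\<bar> * K) * (1 + x\<^sup>2)" for x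
    by (simp add: abs_mult mult.assoc mult_left_mono)
  then show ?thesis unfolding quad_bounded_def by blast
qed

lemma quad_bounded_const: "quad_bounded (\<lambda>x. c)"
  unfolding quad_bounded_def by (intro exI[of _ "\<bar>c\<bar>"]) (simp add: algebra_simps)

lemma quad_bounded_diff:
  assumes "quad_bounded f" "quad_bounded g"
  shows "quad_bounded (\<lambda>x. f x - g x)"
  using quad_bounded_add[OF assms(1) quad_bounded_mult_const[OF assms(2), of "-1"]] by simp

lemma quad_bounded_reflect:
  assumes "quad_bounded f"
  shows "quad_bounded (\<lambda>x. f (c - x))"
proof -
  obtain K where K: "\<And>x. \<bar>f x\<bar> \<le> K * (1 + x\<^sup>2)"
    using assms unfolding quad_bounded_def by blast
  have K0: "K \<ge> 0" using K[of 0] by simp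
  have "\<bar>f (c - x)\<bar> \<le> (K * (2 + 2 * c\<^sup>2)) * (1 + x\<^sup>2)" for x
  proof -
    have "0 \<le> (c + x)\<^sup>2" "0 \<le> c\<^sup>2 * x\<^sup>2" by simp_all
    then have "1 + (c - x)\<^sup>2 \<le> (2 + 2 * c\<^sup>2) * (1 + x\<^sup>2)"
      by (simp add: power2_eq_square algebra_simps)
    then show ?thesis
      using K[of "c - x"] mult_left_mono[OF _ K0] by (fastforce simp: mult.assoc)
  qed
  then show ?thesis unfolding quad_bounded_def by blast
qed

lemma quad_bounded_exp_tendsto_0:
  assumes "quad_bounded f" "\<alpha> > 0"
  shows "((\<lambda>x. exp (- \<alpha> * x) * f (b + c * x)) \<longlongrightarrow> 0) at_top"
proof -
  obtain K where K: "\<And>x. \<bar>f x\<bar> \<le> K * (1 + x\<^sup>2)"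
    using assms unfolding quad_bounded_def by blast
  have "((\<lambda>x. exp (- \<alpha> * x)) \<longlongrightarrow> 0) at_top" "((\<lambda>x. x * exp (- \<alpha> * x)) \<longlongrightarrow> 0) at_top"
    "((\<lambda>x. x\<^sup>2 * exp (- \<alpha> * x)) \<longlongrightarrow> 0) at_top"
    using assms(2) by real_asymp+
  then have "((\<lambda>x. K * (1 + b\<^sup>2) * exp (- \<alpha> * x) + 2 * K * b * c * (x * exp (- \<alpha> * x))
      + K * c\<^sup>2 * (x\<^sup>2 * exp (- \<alpha> * x))) \<longlongrightarrow> 0) at_top"
    by (intro tendsto_add_zero tendsto_mult_right_zero)
  then have "((\<lambda>x. exp (- \<alpha> * x) * (K * (1 + (b + c * x)\<^sup>2))) \<longlongrightarrow> 0) at_top"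
    by (simp add: power2_eq_square algebra_simps)
  then show ?thesis
    by (rule Lim_null_comparison[rotated])
       (use K in \<open>auto simp: abs_mult intro!: always_eventually mult_left_mono\<close>)
qed

text \<open>The constant of integration is fixed without an improper integral: for any
  antiderivative \<open>F\<close>, \<open>F + \<theta>\<close> increases and
  \<open>F - \<theta>\<close> decreases, so every value of \<open>F - \<theta>\<close> lies below
  every value of \<open>F + \<theta>\<close>. Subtracting a number \<open>L\<close> that separates
  them gives the bound.\<close>

lemma antiderivative_bounded:
  fixes \<psi> \<theta> :: "real \<Rightarrow> real"
  assumes "continuous_on UNIV \<psi>"
    and \<theta>: "\<And>x. (\<theta> has_real_derivative \<theta>' x) (at x)" "\<And>x. \<theta> x \<ge> 0"
    and le: "\<And>x. \<bar>\<psi> x\<bar> \<le> \<theta>' x"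
  shows "\<exists>\<Psi>. (\<forall>x. (\<Psi> has_real_derivative \<psi> x) (at x)) \<and> (\<forall>x. \<bar>\<Psi> x\<bar> \<le> \<theta> x)"
proof -
  have "\<exists>F. \<forall>x::real. -\<infinity> < ereal x \<longrightarrow> ereal x < \<infinity> \<longrightarrow> (F has_vector_derivative \<psi> x) (at x)"
    by (rule einterval_antiderivative) (use assms(1) in \<open>auto simp: continuous_on_eq_continuous_at\<close>)
  then obtain F where F: "\<And>x. (F has_real_derivative \<psi> x) (at x)"
    by (auto simp: has_real_derivative_iff_has_vector_derivative)
  have mono: "F x + \<theta> x \<le> F y + \<theta> y" if "x \<le> y" for x y
    using that by (rule DERIV_nonneg_imp_nondecreasing)
      (metis DERIV_add F \<theta>(1) le abs_le_iff add.commute diff_ge_0_iff_ge diff_minus_eq_add)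
  have anti: "F y - \<theta> y \<le> F x - \<theta> x" if "x \<le> y" for x y
    using that by (rule DERIV_nonpos_imp_nonincreasing)
      (metis DERIV_diff F \<theta>(1) le abs_le_iff diff_le_0_iff_le)
  have cross: "F x - \<theta> x \<le> F y + \<theta> y" for x y
    using mono[of x y] anti[of y x] \<theta>(2)[of x] \<theta>(2)[of y] by linarith
  define L where "L = Inf (range (\<lambda>y. F y + \<theta> y))"
  have "bdd_below (range (\<lambda>y. F y + \<theta> y))"
    using cross[of 0] by (auto intro!: bdd_belowI)
  then have 1: "L \<le> F x + \<theta> x" for x
    unfolding L_def by (rule cInf_lower[rotated]) simp
  have 2: "F x - \<theta> x \<le> L" for x
    unfolding L_def by (rule cInf_greatest) (use cross in auto)
  have "\<bar>F x - L\<bar> \<le> \<theta> x" for x using 1[of x] 2[of x] by linarith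
  moreover have "((\<lambda>x. F x - L) has_real_derivative \<psi> x) (at x)" for x
    using F[of x] by (auto intro!: derivative_eq_intros)
  ultimately show ?thesis by (intro exI[of _ "\<lambda>x. F x - L"]) blast
qed

(* V x is the integral of exp (-alpha q) * phi (x - q) over q > 0 *)
lemma exp_convolution_exists:
  fixes \<phi> :: "real \<Rightarrow> real"
  assumes "continuous_on UNIV \<phi>" "quad_bounded \<phi>" "\<alpha> > 0"
  shows "\<exists>V. (\<forall>x. (V has_real_derivative \<phi> x - \<alpha> * V x) (at x)) \<and> quad_bounded V"
proof -
  obtain K where K: "\<And>x. \<bar>\<phi> x\<bar> \<le> K * (1 + x\<^sup>2)"
    using assms unfolding quad_bounded_def by blast
  have K0: "K \<ge> 0" using K[of 0] by simp
  \<comment> \<open>\<open>q\<close> solves q' + \<alpha> q = K (1 + x^2): it is the exponential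
    average of the bound on \<phi>, so exp (\<alpha> x) q x can serve as the majorant in
    \<open>antiderivative_bounded\<close>.\<close>
  define q where "q x = (K / \<alpha>) * (1 + x\<^sup>2 - 2 * x / \<alpha> + 2 / \<alpha>\<^sup>2)" for x
  have q0: "q x \<ge> 0" for x
  proof -
    have "1 + x\<^sup>2 - 2 * x / \<alpha> + 2 / \<alpha>\<^sup>2 = 1 + (x - 1 / \<alpha>)\<^sup>2 + (1 / \<alpha>)\<^sup>2"
      using assms(3) by (simp add: field_simps power2_eq_square)
    also have "\<dots> \<ge> 0" by simp
    finally show ?thesis unfolding q_def using K0 assms(3) by simp
  qed
  have "\<exists>\<Psi>. (\<forall>x. (\<Psi> has_real_derivative exp (\<alpha> * x) * \<phi> x) (at x)) \<and>
          (\<forall>x. \<bar>\<Psi> x\<bar> \<le> exp (\<alpha> * x) * q x)"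
  proof (rule antiderivative_bounded)
    show "continuous_on UNIV (\<lambda>x. exp (\<alpha> * x) * \<phi> x)"
      by (intro continuous_intros assms)
    show "((\<lambda>x. exp (\<alpha> * x) * q x) has_real_derivative exp (\<alpha> * x) * (K * (1 + x\<^sup>2))) (at x)" for x
      unfolding q_def using assms(3)
      by (auto intro!: derivative_eq_intros simp: field_simps power2_eq_square)
  qed (use q0 K in \<open>auto simp: abs_mult\<close>)
  then obtain \<Psi> where \<Psi>: "\<And>x. (\<Psi> has_real_derivative exp (\<alpha> * x) * \<phi> x) (at x)"
    "\<And>x. \<bar>\<Psi> x\<bar> \<le> exp (\<alpha> * x) * q x" by blast
  define V where "V x = exp (- \<alpha> * x) * \<Psi> x" for x
  have "(V has_real_derivative \<phi> x - \<alpha> * V x) (at x)" for x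
    unfolding V_def
    by (rule derivative_eq_intros \<Psi> refl)+ (simp add: exp_minus field_simps)
  moreover have "quad_bounded V"
    unfolding quad_bounded_def
  proof (intro exI allI)
    fix x
    have "\<bar>V x\<bar> \<le> q x"
      using \<Psi>(2)[of x] unfolding V_def by (simp add: abs_mult exp_minus field_simps)
    also have "q x \<le> (K / \<alpha>) * ((2 + 3 / \<alpha>\<^sup>2) * (1 + x\<^sup>2))"
      unfolding q_def
    proof (rule mult_left_mono)
      define y where "y = 1 / \<alpha>"
      have "0 \<le> (x + y)\<^sup>2" "0 \<le> x\<^sup>2 * y\<^sup>2" by simp_all
      then have "1 + x\<^sup>2 - 2 * x * y + 2 * y\<^sup>2 \<le> (2 + 3 * y\<^sup>2) * (1 + x\<^sup>2)"
        by (simp add: algebra_simps power2_eq_square)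
      then show "1 + x\<^sup>2 - 2 * x / \<alpha> + 2 / \<alpha>\<^sup>2 \<le> (2 + 3 / \<alpha>\<^sup>2) * (1 + x\<^sup>2)"
        by (simp add: y_def power_divide)
    qed (use K0 assms in simp)
    finally show "\<bar>V x\<bar> \<le> (K / \<alpha> * (2 + 3 / \<alpha>\<^sup>2)) * (1 + x\<^sup>2)" by (simp only: mult.assoc)
  qed
  ultimately show ?thesis by blast
qed

text \<open>Formally \<integral> f d\<phi> = [f \<phi>] - \<alpha> \<integral> f \<phi>, as f' =
  \<alpha> f, and \<integral> f \<phi> = [f V], as (f V)' = f \<phi>. Since \<phi> is merely
  continuous, the sums are compared cell by cell with the increments of f (\<phi> - \<alpha>
  V).\<close>

lemma riemann_stieltjes_sum_limit:
  fixes \<phi> V :: "real \<Rightarrow> real"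
  assumes "\<alpha> > 0" "a \<le> b" and cont: "continuous_on UNIV \<phi>"
    and V: "\<And>x. (V has_real_derivative \<phi> x - \<alpha> * V x) (at x)"
  defines "x \<equiv> \<lambda>n k. a + real k * ((b - a) / real (Suc n))"
    and "f \<equiv> \<lambda>u. exp (- \<alpha> * (b - u))"
  shows "(\<lambda>n. \<Sum>k<Suc n. f (x n k) * (\<phi> (x n (Suc k)) - \<phi> (x n k)))
           \<longlonglongrightarrow> (\<phi> b - \<alpha> * V b) - f a * (\<phi> a - \<alpha> * V a)"
proof -
  define w where "w u = f u * (\<phi> u - \<alpha> * V u)" for u
  have w: "w (x n (Suc n)) - w (x n 0) = (\<phi> b - \<alpha> * V b) - f a * (\<phi> a - \<alpha> * V a)" for n
    by (simp add: w_def x_def f_def)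
  show ?thesis
  proof (rule LIMSEQ_I)
    fix r :: real assume "r > 0"
    define e where "e = r / (2 * (\<alpha> * (b - a) + 1))"
    have pos: "\<alpha> * (b - a) \<ge> 0" using assms by simp
    have e: "e > 0" using \<open>r > 0\<close> pos by (simp add: e_def add_nonneg_pos)
    have "uniformly_continuous_on {a..b} \<phi>"
      by (rule compact_uniformly_continuous) (use cont continuous_on_subset in auto)
    then obtain d where d: "d > 0"
      "\<And>u v. u \<in> {a..b} \<Longrightarrow> v \<in> {a..b} \<Longrightarrow> \<bar>u - v\<bar> < d \<Longrightarrow> \<bar>\<phi> u - \<phi> v\<bar> < e"
      using e unfolding uniformly_continuous_on_def dist_real_def by metis
    obtain n0 :: nat where n0: "(b - a) / d < real n0" using reals_Archimedean2 by blast
    have "norm ((\<Sum>k<Suc n. f (x n k) * (\<phi> (x n (Suc k)) - \<phi> (x n k)))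
           - ((\<phi> b - \<alpha> * V b) - f a * (\<phi> a - \<alpha> * V a))) < r" if "n \<ge> n0" for n
    proof -
      define h where "h = (b - a) / real (Suc n)"
      have h0: "h \<ge> 0" using assms by (simp add: h_def)
      have "b - a < d * real n0" using n0 d(1) by (simp add: field_simps)
      also have "\<dots> \<le> d * real (Suc n)" using that d(1) by simp
      finally have hd: "h < d" unfolding h_def using d(1) by (simp add: field_simps)
      have cell: "\<bar>f (x n k) * (\<phi> (x n (Suc k)) - \<phi> (x n k)) - (w (x n (Suc k)) - w (x n k))\<bar>
                    \<le> h * (\<alpha> * e)" if k: "k < Suc n" for k
      proof -
        have xs: "x n (Suc k) = x n k + h" by (simp add: x_def h_def distrib_right add_divide_distrib)
        have xa: "a \<le> x n k" using h0 unfolding x_def h_def[symmetric] by simp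
        have "real (Suc k) * h \<le> real (Suc n) * h" by (rule mult_right_mono) (use k h0 in auto)
        also have "\<dots> = b - a" by (simp add: h_def)
        finally have xb: "x n (Suc k) \<le> b" unfolding x_def h_def[symmetric] by simp
        define c where "c = \<phi> (x n (Suc k))"
        \<comment> \<open>Freezing \<phi> at the right end point, with value \<open>c\<close>, makes
          the error of a cell an increment of the differentiable function \<theta>. Its derivative
          \<alpha> f (\<phi> - c) is small by uniform continuity, so the mean value theorem applies
          although \<phi> itself need not be differentiable.\<close>
        define \<theta> where "\<theta> p = \<alpha> * (f p * V p) - c * f p" for p
        have \<theta>': "(\<theta> has_real_derivative \<alpha> * f p * (\<phi> p - c)) (at p)" for p
          unfolding \<theta>_def f_def
          by (rule derivative_eq_intros V refl)+ (simp add: algebra_simps)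
        have eq: "f (x n k) * (\<phi> (x n (Suc k)) - \<phi> (x n k)) - (w (x n (Suc k)) - w (x n k))
               = \<theta> (x n (Suc k)) - \<theta> (x n k)"
          by (simp add: \<theta>_def w_def c_def algebra_simps)
        have "\<bar>\<theta> (x n (Suc k)) - \<theta> (x n k)\<bar> \<le> h * (\<alpha> * e)"
        proof (cases "h = 0")
          case False
          with h0 have lt: "x n k < x n (Suc k)" by (simp add: xs)
          obtain z where z: "x n k < z" "z < x n (Suc k)"
            "\<theta> (x n (Suc k)) - \<theta> (x n k) = (x n (Suc k) - x n k) * (\<alpha> * f z * (\<phi> z - c))"
            using MVT2[OF lt, of \<theta> "\<lambda>p. \<alpha> * f p * (\<phi> p - c)"] \<theta>' by blast
          have "\<bar>\<phi> z - c\<bar> < e" unfolding c_def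
            by (rule d(2)) (use z xa xb xs hd in auto)
          moreover have "0 < f z" "f z \<le> 1" using z xb assms(1) by (auto simp: f_def)
          ultimately have "f z * \<bar>\<phi> z - c\<bar> \<le> 1 * e" by (intro mult_mono) auto
          then have "\<alpha> * f z * \<bar>\<phi> z - c\<bar> \<le> \<alpha> * e"
            using assms(1) by (simp add: mult.assoc)
          moreover have "\<bar>\<theta> (x n (Suc k)) - \<theta> (x n k)\<bar> = h * (\<alpha> * f z * \<bar>\<phi> z - c\<bar>)"
            unfolding z(3) using xs h0 assms(1) \<open>0 < f z\<close> by (simp add: abs_mult)
          ultimately show ?thesis using h0 by (simp add: mult_left_mono)
        qed (simp add: xs)
        then show ?thesis by (simp only: eq)
      qed
      have "(\<Sum>k<Suc n. f (x n k) * (\<phi> (x n (Suc k)) - \<phi> (x n k)))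
           - ((\<phi> b - \<alpha> * V b) - f a * (\<phi> a - \<alpha> * V a))
        = (\<Sum>k<Suc n. f (x n k) * (\<phi> (x n (Suc k)) - \<phi> (x n k)) - (w (x n (Suc k)) - w (x n k)))"
        by (subst sum_subtractf, subst sum_lessThan_telescope, subst w, rule refl)
      also have "\<bar>\<dots>\<bar> \<le> (\<Sum>k<Suc n. h * (\<alpha> * e))"
        by (rule order_trans[OF sum_abs]) (rule sum_mono, use cell in simp)
      also have "\<dots> = \<alpha> * (b - a) * e" by (simp add: h_def field_simps)
      also have "\<dots> < r"
      proof -
        have "\<alpha> * (b - a) * e \<le> (\<alpha> * (b - a) + 1) * e" using e by (simp add: mult_right_mono)
        also have "\<dots> = r / 2" using pos by (simp add: e_def field_simps add_nonneg_pos)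
        finally show ?thesis using \<open>r > 0\<close> by simp
      qed
      finally show ?thesis by simp
    qed
    then show "\<exists>no. \<forall>n\<ge>no. norm ((\<Sum>k<Suc n. f (x n k) * (\<phi> (x n (Suc k)) - \<phi> (x n k)))
           - ((\<phi> b - \<alpha> * V b) - f a * (\<phi> a - \<alpha> * V a))) < r" by blast
  qed
qed

section \<open>Asymptotic expansions of exponential averages\<close>

text \<open>If F' / g' < d eventually, then F - d g is eventually nondecreasing because g' < 0; as
  it tends to 0 it is nonpositive, whence F / g \<le> d. Applied to f and to - f, this squeezes the
  quotient.\<close>

lemma lhopital_0_at_top:
  fixes f g :: "real \<Rightarrow> real"
  assumes f0: "(f \<longlongrightarrow> 0) at_top" and g0: "(g \<longlongrightarrow> 0) at_top"
    and Df: "\<forall>\<^sub>F x in at_top. (f has_real_derivative f' x) (at x)"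
    and Dg: "\<forall>\<^sub>F x in at_top. (g has_real_derivative g' x) (at x)"
    and pos: "\<forall>\<^sub>F x in at_top. g x > 0" and neg: "\<forall>\<^sub>F x in at_top. g' x < 0"
    and lim: "((\<lambda>x. f' x / g' x) \<longlongrightarrow> c) at_top"
  shows "((\<lambda>x. f x / g x) \<longlongrightarrow> c) at_top"
proof -
  have upper: "\<forall>\<^sub>F x in at_top. F x / g x \<le> d"
    if F0: "(F \<longlongrightarrow> 0) at_top" and F': "\<forall>\<^sub>F x in at_top. (F has_real_derivative F' x) (at x)"
      "\<forall>\<^sub>F x in at_top. F' x / g' x < d" for F F' :: "real \<Rightarrow> real" and d
  proof -
    have "\<forall>\<^sub>F x in at_top. (F has_real_derivative F' x) (at x) \<and> F' x / g' x < d \<and>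
        (g has_real_derivative g' x) (at x) \<and> g x > 0 \<and> g' x < 0"
      using F' Dg pos neg by eventually_elim blast
    then obtain X where X: "\<And>x. x \<ge> X \<Longrightarrow>
        (F has_real_derivative F' x) (at x) \<and> F' x / g' x < d \<and>
        (g has_real_derivative g' x) (at x) \<and> g x > 0 \<and> g' x < 0"
      unfolding eventually_at_top_linorder by blast
    have "F x / g x \<le> d" if "x \<ge> X" for x
    proof -
      have "F x - d * g x \<le> F y - d * g y" if "x \<le> y" for y
      proof (rule DERIV_nonneg_imp_nondecreasing[OF that])
        fix z assume "x \<le> z"
        with X[of z] \<open>x \<ge> X\<close> show "\<exists>l. ((\<lambda>z. F z - d * g z) has_real_derivative l) (at z) \<and> 0 \<le> l"
          by (intro exI[of _ "F' z - d * g' z"])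
            (auto intro!: derivative_eq_intros simp: divide_less_eq less_imp_le)
      qed
      then have "\<forall>\<^sub>F y in at_top. F x - d * g x \<le> F y - d * g y"
        by (auto simp: eventually_at_top_linorder)
      moreover have "((\<lambda>y. F y - d * g y) \<longlongrightarrow> 0 - d * 0) at_top"
        by (intro tendsto_intros F0 g0)
      ultimately have "F x - d * g x \<le> 0"
        by (intro tendsto_lowerbound[of "\<lambda>y. F y - d * g y"]) auto
      then show ?thesis using X[of x] that by (simp add: divide_le_eq)
    qed
    then show ?thesis by (auto simp: eventually_at_top_linorder)
  qed
  show ?thesis
  proof (rule order_tendstoI)
    fix a assume "a > c"
    then have "\<forall>\<^sub>F x in at_top. f x / g x \<le> (a + c) / 2"
      by (intro upper[OF f0 Df] order_tendstoD[OF lim]) (simp add: field_simps)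
    then show "\<forall>\<^sub>F x in at_top. f x / g x < a"
    proof eventually_elim
      case (elim x)
      moreover have "(a + c) / 2 < a" using \<open>a > c\<close> by simp
      ultimately show ?case by linarith
    qed
  next
    fix a assume "a < c"
    have "\<forall>\<^sub>F x in at_top. - f x / g x \<le> - ((a + c) / 2)"
    proof (rule upper)
      show "((\<lambda>x. - f x) \<longlongrightarrow> 0) at_top" using tendsto_minus[OF f0] by simp
      show "\<forall>\<^sub>F x in at_top. ((\<lambda>x. - f x) has_real_derivative - f' x) (at x)"
        using Df by eventually_elim (rule DERIV_minus)
      have "\<forall>\<^sub>F x in at_top. f' x / g' x > (a + c) / 2"
        by (rule order_tendstoD(1)[OF lim]) (use \<open>a < c\<close> in \<open>simp add: field_simps\<close>)
      then show "\<forall>\<^sub>F x in at_top. - f' x / g' x < - ((a + c) / 2)"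
        by eventually_elim simp
    qed
    then show "\<forall>\<^sub>F x in at_top. a < f x / g x"
    proof eventually_elim
      case (elim x)
      then have "(a + c) / 2 \<le> f x / g x" by simp
      moreover have "a < (a + c) / 2" using \<open>a < c\<close> by simp
      ultimately show ?case by linarith
    qed
  qed
qed

text \<open>Homogeneous solutions decay exponentially, so every solution has the same leading order.
  The quotient is extended by exp (\<alpha> x) to make the denominator tend to infinity, a form of
  l'Hopital's rule that asks nothing of the numerator.\<close>

lemma stable_ode_asymptotics:
  fixes D :: "real \<Rightarrow> real"
  assumes "\<alpha> > 0"
    and D: "\<And>x. x > 0 \<Longrightarrow> (D has_real_derivative \<kappa> * x powr a - \<alpha> * D x) (at x)"
  shows "((\<lambda>x. D x / x powr a) \<longlongrightarrow> \<kappa> / \<alpha>) at_top"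
proof -
  have "((\<lambda>x. (exp (\<alpha> * x) * D x) / (exp (\<alpha> * x) * x powr a)) \<longlongrightarrow> \<kappa> / \<alpha>) at_top"
  proof (rule lhospital_at_top_at_top)
    show "LIM x at_top. exp (\<alpha> * x) * x powr a :> at_top"
      using assms(1) by real_asymp
    have "\<forall>\<^sub>F x in at_top. \<alpha> + a / x > 0" using assms(1) by real_asymp
    then show "\<forall>\<^sub>F x in at_top. exp (\<alpha> * x) * (x powr a * (\<alpha> + a / x)) \<noteq> 0"
      using eventually_gt_at_top[of 0] by eventually_elim simp
    show "\<forall>\<^sub>F x in at_top. ((\<lambda>x. exp (\<alpha> * x) * D x) has_real_derivative
             exp (\<alpha> * x) * (\<kappa> * x powr a)) (at x)"
      using eventually_gt_at_top[of 0]
      by eventually_elim (rule derivative_eq_intros D refl | assumption | simp add: algebra_simps)+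
    show "\<forall>\<^sub>F x in at_top. ((\<lambda>x. exp (\<alpha> * x) * x powr a) has_real_derivative
             exp (\<alpha> * x) * (x powr a * (\<alpha> + a / x))) (at x)"
      using eventually_gt_at_top[of 0]
      by eventually_elim (auto intro!: derivative_eq_intros simp: field_simps powr_diff)
    have "((\<lambda>x. \<kappa> / (\<alpha> + a / x)) \<longlongrightarrow> \<kappa> / (\<alpha> + 0)) at_top"
      by (intro tendsto_intros real_tendsto_divide_at_top[of _ a] filterlim_ident) (use assms(1) in auto)
    then have "((\<lambda>x. \<kappa> / (\<alpha> + a / x)) \<longlongrightarrow> \<kappa> / \<alpha>) at_top" by simp
    moreover have "\<forall>\<^sub>F x in at_top. \<kappa> / (\<alpha> + a / x)
        = exp (\<alpha> * x) * (\<kappa> * x powr a) / (exp (\<alpha> * x) * (x powr a * (\<alpha> + a / x)))"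
      using eventually_gt_at_top[of 0] by eventually_elim simp
    ultimately show "((\<lambda>x. exp (\<alpha> * x) * (\<kappa> * x powr a) / (exp (\<alpha> * x) * (x powr a * (\<alpha> + a / x))))
        \<longlongrightarrow> \<kappa> / \<alpha>) at_top"
      by (rule Lim_transform_eventually)
  qed
  then show ?thesis by simp
qed

text \<open>Here homogeneous solutions are multiples of exp (\<alpha> x), and the growth condition
  singles out the one solution without such a part. After extension by exp (- \<alpha> x) the
  quotient has the form 0 / 0.\<close>

lemma unstable_ode_asymptotics:
  fixes D :: "real \<Rightarrow> real"
  assumes "\<alpha> > 0" and D0: "((\<lambda>x. exp (- \<alpha> * x) * D x) \<longlongrightarrow> 0) at_top"
    and D: "\<And>x. x > 0 \<Longrightarrow> (D has_real_derivative \<alpha> * D x - \<kappa> * x powr a) (at x)"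
  shows "((\<lambda>x. D x / x powr a) \<longlongrightarrow> \<kappa> / \<alpha>) at_top"
proof -
  have "((\<lambda>x. (exp (- \<alpha> * x) * D x) / (exp (- \<alpha> * x) * x powr a)) \<longlongrightarrow> \<kappa> / \<alpha>) at_top"
  proof (rule lhopital_0_at_top[OF D0])
    show "((\<lambda>x. exp (- \<alpha> * x) * x powr a) \<longlongrightarrow> 0) at_top"
      using assms(1) by real_asymp
    show "\<forall>\<^sub>F x in at_top. 0 < exp (- \<alpha> * x) * x powr a"
      using eventually_gt_at_top[of 0] by eventually_elim simp
    have "\<forall>\<^sub>F x in at_top. \<alpha> - a / x > 0" using assms(1) by real_asymp
    then show "\<forall>\<^sub>F x in at_top. - (exp (- \<alpha> * x) * (x powr a * (\<alpha> - a / x))) < 0"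
      using eventually_gt_at_top[of 0] by eventually_elim simp
    show "\<forall>\<^sub>F x in at_top. ((\<lambda>x. exp (- \<alpha> * x) * D x) has_real_derivative
             - (exp (- \<alpha> * x) * (\<kappa> * x powr a))) (at x)"
      using eventually_gt_at_top[of 0]
      by eventually_elim (rule derivative_eq_intros D refl | assumption | simp add: algebra_simps)+
    show "\<forall>\<^sub>F x in at_top. ((\<lambda>x. exp (- \<alpha> * x) * x powr a) has_real_derivative
             - (exp (- \<alpha> * x) * (x powr a * (\<alpha> - a / x)))) (at x)"
      using eventually_gt_at_top[of 0]
      by eventually_elim (auto intro!: derivative_eq_intros simp: field_simps powr_diff)
    have "((\<lambda>x. \<kappa> / (\<alpha> - a / x)) \<longlongrightarrow> \<kappa> / (\<alpha> - 0)) at_top"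
      by (intro tendsto_intros real_tendsto_divide_at_top[of _ a] filterlim_ident) (use assms(1) in auto)
    then have "((\<lambda>x. \<kappa> / (\<alpha> - a / x)) \<longlongrightarrow> \<kappa> / \<alpha>) at_top" by simp
    moreover have "\<forall>\<^sub>F x in at_top. \<kappa> / (\<alpha> - a / x)
        = - (exp (- \<alpha> * x) * (\<kappa> * x powr a)) / - (exp (- \<alpha> * x) * (x powr a * (\<alpha> - a / x)))"
      using eventually_gt_at_top[of 0] by eventually_elim simp
    ultimately show "((\<lambda>x. - (exp (- \<alpha> * x) * (\<kappa> * x powr a)) / - (exp (- \<alpha> * x) * (x powr a * (\<alpha> - a / x))))
        \<longlongrightarrow> \<kappa> / \<alpha>) at_top"
      by (rule Lim_transform_eventually)
  qed
  then show ?thesis by simp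
qed

text \<open>With d for differentiation, P = (\<alpha> - d)^(-1) G and Q = (\<beta> + d)^(-1) G.
  Truncating the two geometric series in d leaves remainders that solve the same equations, driven
  by a single derivative of G.\<close>

lemma ou_kernel_expansion:
  fixes P Q :: "real \<Rightarrow> real" and G :: "nat \<Rightarrow> real \<Rightarrow> real" and N :: nat
  assumes pos: "\<alpha> > 0" "\<beta> > 0"
    and P: "\<And>x. x > 0 \<Longrightarrow> (P has_real_derivative \<alpha> * P x - G 0 x) (at x)"
    and P0: "((\<lambda>x. exp (- \<alpha> * x) * P x) \<longlongrightarrow> 0) at_top"
    and Q: "\<And>x. x > 0 \<Longrightarrow> (Q has_real_derivative G 0 x - \<beta> * Q x) (at x)"
    and G: "\<And>n x. x > 0 \<Longrightarrow> (G n has_real_derivative G (Suc n) x) (at x)"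
    and G0: "\<And>n. ((\<lambda>x. exp (- \<alpha> * x) * G n x) \<longlongrightarrow> 0) at_top"
    and top: "\<And>x. x > 0 \<Longrightarrow> G (N + 3) x = \<kappa> * x powr a"
  shows "((\<lambda>x. (\<alpha>\<^sup>2 / (\<alpha> + \<beta>) * P x + \<beta>\<^sup>2 / (\<alpha> + \<beta>) * Q x - G 0 x
             - (\<Sum>n=0..N. ((- 1) ^ n / \<beta> ^ (n + 1) + 1 / \<alpha> ^ (n + 1)) / (\<alpha> + \<beta>) * G (n + 2) x))
            / x powr a)
     \<longlongrightarrow> \<kappa> * (1 / \<alpha> ^ (N + 2) - ((- 1) ^ N) / \<beta> ^ (N + 2)) / (\<alpha> + \<beta>)) at_top"
proof -
  \<comment> \<open>As orders 0 and 1 cancel, the terms n \<le> N of the claim involve derivatives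
    up to N + 2. The remainders are then driven by \<open>G (N + 3)\<close>, the pure power of
    hypothesis \<open>top\<close>.\<close>
  define K where "K = N + 2"
  define DP where "DP x = P x - (\<Sum>n\<le>K. G n x / \<alpha> ^ (n + 1))" for x
  define DQ where "DQ x = Q x - (\<Sum>n\<le>K. (- 1) ^ n * G n x / \<beta> ^ (n + 1))" for x
  have teleP: "(\<Sum>n\<le>k. G (Suc n) x / \<alpha> ^ (n + 1))
      = \<alpha> * (\<Sum>n\<le>k. G n x / \<alpha> ^ (n + 1)) + G (Suc k) x / \<alpha> ^ (k + 1) - G 0 x" for k x
  proof (induction k)
    case (Suc k)
    have "\<alpha> * (G (Suc k) x / \<alpha> ^ (Suc k + 1)) = G (Suc k) x / \<alpha> ^ (k + 1)"
      using pos by simp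
    then show ?case unfolding sum.atMost_Suc distrib_left Suc by linarith
  qed (use pos in simp)
  have teleQ: "(\<Sum>n\<le>k. (- 1) ^ n * G (Suc n) x / \<beta> ^ (n + 1))
      = G 0 x - \<beta> * (\<Sum>n\<le>k. (- 1) ^ n * G n x / \<beta> ^ (n + 1)) + (- 1) ^ k * G (Suc k) x / \<beta> ^ (k + 1)" for k x
  proof (induction k)
    case (Suc k)
    have "\<beta> * ((- 1) ^ Suc k * G (Suc k) x / \<beta> ^ (Suc k + 1)) = - ((- 1) ^ k * G (Suc k) x / \<beta> ^ (k + 1))"
      using pos by simp
    then show ?case unfolding sum.atMost_Suc distrib_left Suc by linarith
  qed (use pos in simp)
  have top': "G (Suc K) x = \<kappa> * x powr a" if "x > 0" for x
    using top[OF that] by (simp add: K_def eval_nat_numeral)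
  have limP: "((\<lambda>x. DP x / x powr a) \<longlongrightarrow> (\<kappa> / \<alpha> ^ (K + 1)) / \<alpha>) at_top"
  proof (rule unstable_ode_asymptotics[OF pos(1)])
    have "((\<lambda>x. exp (- \<alpha> * x) * P x - (\<Sum>n\<le>K. (exp (- \<alpha> * x) * G n x) / \<alpha> ^ (n + 1))) \<longlongrightarrow>
             0 - (\<Sum>n\<le>K. 0 / \<alpha> ^ (n + 1))) at_top"
      by (intro tendsto_intros P0 G0) (use pos in auto)
    then show "((\<lambda>x. exp (- \<alpha> * x) * DP x) \<longlongrightarrow> 0) at_top"
      by (simp add: DP_def right_diff_distrib sum_distrib_left)
    fix x :: real assume x: "x > 0"
    have "(DP has_real_derivative (\<alpha> * P x - G 0 x) - (\<Sum>n\<le>K. G (Suc n) x / \<alpha> ^ (n + 1))) (at x)"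
      unfolding DP_def by (intro DERIV_diff DERIV_sum DERIV_cdivide P G x)
    moreover have "(\<alpha> * P x - G 0 x) - (\<Sum>n\<le>K. G (Suc n) x / \<alpha> ^ (n + 1))
        = \<alpha> * DP x - \<kappa> / \<alpha> ^ (K + 1) * x powr a"
      by (simp only: teleP top'[OF x] DP_def) (simp add: algebra_simps)
    ultimately show "(DP has_real_derivative \<alpha> * DP x - \<kappa> / \<alpha> ^ (K + 1) * x powr a) (at x)"
      by simp
  qed
  have limQ: "((\<lambda>x. DQ x / x powr a) \<longlongrightarrow> (- ((- 1) ^ K) * \<kappa> / \<beta> ^ (K + 1)) / \<beta>) at_top"
  proof (rule stable_ode_asymptotics[OF pos(2)])
    fix x :: real assume x: "x > 0"
    have "(DQ has_real_derivative (G 0 x - \<beta> * Q x) - (\<Sum>n\<le>K. (- 1) ^ n * G (Suc n) x / \<beta> ^ (n + 1))) (at x)"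
      unfolding DQ_def by (intro DERIV_diff DERIV_sum DERIV_cdivide DERIV_cmult Q G x)
    moreover have "(G 0 x - \<beta> * Q x) - (\<Sum>n\<le>K. (- 1) ^ n * G (Suc n) x / \<beta> ^ (n + 1))
        = - ((- 1) ^ K) * \<kappa> / \<beta> ^ (K + 1) * x powr a - \<beta> * DQ x"
      by (simp only: teleQ top'[OF x] DQ_def) (simp add: algebra_simps)
    ultimately show "(DQ has_real_derivative - ((- 1) ^ K) * \<kappa> / \<beta> ^ (K + 1) * x powr a - \<beta> * DQ x) (at x)"
      by simp
  qed
  have sum_shift: "(\<Sum>n\<le>N + 2. f n) = f 0 + f 1 + (\<Sum>n=0..N. f (n + 2))" for f :: "nat \<Rightarrow> real"
    by (induction N) (auto simp: eval_nat_numeral)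
  have split: "\<alpha>\<^sup>2 / (\<alpha> + \<beta>) * P x + \<beta>\<^sup>2 / (\<alpha> + \<beta>) * Q x - G 0 x
             - (\<Sum>n=0..N. ((- 1) ^ n / \<beta> ^ (n + 1) + 1 / \<alpha> ^ (n + 1)) / (\<alpha> + \<beta>) * G (n + 2) x)
      = \<alpha>\<^sup>2 / (\<alpha> + \<beta>) * DP x + \<beta>\<^sup>2 / (\<alpha> + \<beta>) * DQ x" for x
  proof -
    \<comment> \<open>\<open>T n\<close> gathers order n of both series. At order 0 the weights give
      \<alpha> / (\<alpha> + \<beta>) + \<beta> / (\<alpha> + \<beta>) = 1, at order 1 the two
      contributions have opposite signs, and from order 2 on the squares in the weights cancel two
      powers of the denominators.\<close>
    define T where "T n = \<alpha>\<^sup>2 / (\<alpha> + \<beta>) * (G n x / \<alpha> ^ (n + 1))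
                   + \<beta>\<^sup>2 / (\<alpha> + \<beta>) * ((- 1) ^ n * G n x / \<beta> ^ (n + 1))" for n
    have ab: "\<alpha> + \<beta> \<noteq> 0" "\<alpha> \<noteq> 0" "\<beta> \<noteq> 0" using pos by auto
    have "T 0 = \<alpha> * G 0 x / (\<alpha> + \<beta>) + \<beta> * G 0 x / (\<alpha> + \<beta>)"
      using ab(2,3) by (simp add: T_def power2_eq_square)
    also have "\<dots> = (\<alpha> + \<beta>) * G 0 x / (\<alpha> + \<beta>)"
      by (simp only: add_divide_distrib distrib_right)
    finally have T0: "T 0 = G 0 x" using ab(1) by simp
    have T1: "T 1 = 0" using ab(2,3) by (simp add: T_def power2_eq_square)
    have T2: "T (n + 2) = ((- 1) ^ n / \<beta> ^ (n + 1) + 1 / \<alpha> ^ (n + 1)) / (\<alpha> + \<beta>) * G (n + 2) x" for n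
    proof -
      have "c\<^sup>2 / d * (g / c ^ (n + 2 + 1)) = 1 / c ^ (n + 1) / d * g" if "c \<noteq> 0" for c d g :: real
        using that by (simp add: power2_eq_square)
      from this[OF ab(2)] this[OF ab(3)] show ?thesis
        by (simp only: T_def) (simp add: distrib_right add_divide_distrib)
    qed
    have "(\<Sum>n\<le>N + 2. T n) = G 0 x
        + (\<Sum>n=0..N. ((- 1) ^ n / \<beta> ^ (n + 1) + 1 / \<alpha> ^ (n + 1)) / (\<alpha> + \<beta>) * G (n + 2) x)"
      by (simp only: sum_shift T0 T1 T2 add_0_right)
    moreover have "(\<Sum>n\<le>N + 2. T n) = \<alpha>\<^sup>2 / (\<alpha> + \<beta>) * (P x - DP x) + \<beta>\<^sup>2 / (\<alpha> + \<beta>) * (Q x - DQ x)"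
      by (simp only: T_def DP_def DQ_def K_def sum.distrib sum_distrib_left diff_diff_eq2 add_diff_cancel_left')
    ultimately show ?thesis unfolding right_diff_distrib by linarith
  qed
  have "((\<lambda>x. \<alpha>\<^sup>2 / (\<alpha> + \<beta>) * (DP x / x powr a) + \<beta>\<^sup>2 / (\<alpha> + \<beta>) * (DQ x / x powr a)) \<longlongrightarrow>
      \<alpha>\<^sup>2 / (\<alpha> + \<beta>) * ((\<kappa> / \<alpha> ^ (K + 1)) / \<alpha>) + \<beta>\<^sup>2 / (\<alpha> + \<beta>) * ((- ((- 1) ^ K) * \<kappa> / \<beta> ^ (K + 1)) / \<beta>)) at_top"
    by (intro tendsto_intros limP limQ)
  moreover have "\<alpha>\<^sup>2 / (\<alpha> + \<beta>) * ((\<kappa> / \<alpha> ^ (K + 1)) / \<alpha>) + \<beta>\<^sup>2 / (\<alpha> + \<beta>) * ((- ((- 1) ^ K) * \<kappa> / \<beta> ^ (K + 1)) / \<beta>)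
      = \<kappa> * (1 / \<alpha> ^ (N + 2) - ((- 1) ^ N) / \<beta> ^ (N + 2)) / (\<alpha> + \<beta>)"
  proof -
    have "c\<^sup>2 / d * (k / c ^ (K + 1) / c) = k / c ^ (N + 2) / d" if "c > 0" for c d k :: real
      using that by (simp add: K_def power2_eq_square)
    moreover have "(- 1) ^ K = ((- 1) ^ N :: real)" by (simp add: K_def)
    ultimately show ?thesis
      using pos by (simp add: diff_divide_distrib right_diff_distrib)
  qed
  ultimately show ?thesis unfolding split by (simp add: add_divide_distrib)
qed

section \<open>Almost sure limits of Gaussian variables\<close>

text \<open>\<open>centered_gaussian_process\<close> fixes one finite index set and one coefficient
  function. This form is closed under sums and differences, which brings Riemann-Stieltjes sums over
  different partitions, and their differences, into its scope.\<close>

definition linear_combination :: "'k set \<Rightarrow> ('k \<Rightarrow> 'a \<Rightarrow> real) \<Rightarrow> ('a \<Rightarrow> real) \<Rightarrow> bool" where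
  "linear_combination I X Z \<longleftrightarrow> (\<exists>F c. finite F \<and> F \<subseteq> I \<and> Z = (\<lambda>\<omega>. \<Sum>k\<in>F. c k * X k \<omega>))"

lemma linear_combination_base:
  "k \<in> I \<Longrightarrow> linear_combination I X (X k)"
  unfolding linear_combination_def by (intro exI[of _ "{k}"] exI[of _ "\<lambda>_. 1"]) auto

lemma linear_combination_zero: "linear_combination I X (\<lambda>\<omega>. 0)"
  unfolding linear_combination_def by (intro exI[of _ "{}"]) auto

lemma linear_combination_cmult:
  assumes "linear_combination I X Z"
  shows "linear_combination I X (\<lambda>\<omega>. a * Z \<omega>)"
proof -
  obtain F c where "finite F" "F \<subseteq> I" "Z = (\<lambda>\<omega>. \<Sum>k\<in>F. c k * X k \<omega>)"
    using assms unfolding linear_combination_def by blast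
  then show ?thesis unfolding linear_combination_def
    by (intro exI[of _ F] exI[of _ "\<lambda>k. a * c k"]) (simp add: sum_distrib_left mult.assoc)
qed

lemma linear_combination_add:
  assumes "linear_combination I X Z" "linear_combination I X W"
  shows "linear_combination I X (\<lambda>\<omega>. Z \<omega> + W \<omega>)"
proof -
  obtain F c where F: "finite F" "F \<subseteq> I" "Z = (\<lambda>\<omega>. \<Sum>k\<in>F. c k * X k \<omega>)"
    using assms(1) unfolding linear_combination_def by blast
  obtain G d where G: "finite G" "G \<subseteq> I" "W = (\<lambda>\<omega>. \<Sum>k\<in>G. d k * X k \<omega>)"
    using assms(2) unfolding linear_combination_def by blast
  have "(\<Sum>k\<in>F. c k * X k \<omega>) = (\<Sum>k\<in>F \<union> G. (if k \<in> F then c k else 0) * X k \<omega>)" for \<omega>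
    using F(1) G(1) by (intro sum.mono_neutral_cong_left) auto
  moreover have "(\<Sum>k\<in>G. d k * X k \<omega>) = (\<Sum>k\<in>F \<union> G. (if k \<in> G then d k else 0) * X k \<omega>)" for \<omega>
    using F(1) G(1) by (intro sum.mono_neutral_cong_left) auto
  ultimately have "(\<lambda>\<omega>. Z \<omega> + W \<omega>) = (\<lambda>\<omega>. \<Sum>k\<in>F \<union> G.
      ((if k \<in> F then c k else 0) + (if k \<in> G then d k else 0)) * X k \<omega>)"
    unfolding F(3) G(3) by (simp add: sum.distrib distrib_right)
  with F G show ?thesis unfolding linear_combination_def
    by (intro exI[of _ "F \<union> G"] exI) auto
qed

lemma linear_combination_diff:
  assumes "linear_combination I X Z" "linear_combination I X W"
  shows "linear_combination I X (\<lambda>\<omega>. Z \<omega> - W \<omega>)"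
  using linear_combination_add[OF assms(1) linear_combination_cmult[OF assms(2), of "- 1"]] by simp

lemma linear_combination_sum:
  assumes "\<And>k. k \<in> A \<Longrightarrow> linear_combination I X (Z k)"
  shows "linear_combination I X (\<lambda>\<omega>. \<Sum>k\<in>A. Z k \<omega>)"
proof (cases "finite A")
  case True
  then show ?thesis using assms
    by induction (auto intro: linear_combination_zero linear_combination_add)
qed (simp add: linear_combination_zero)

(* All that is used of normality is the characteristic function at 1: this much passes to almost
   sure limits by dominated convergence, without identifying the limit distribution. *)
definition gaussian_like :: "'a measure \<Rightarrow> ('a \<Rightarrow> real) \<Rightarrow> bool" where
  "gaussian_like M Z \<longleftrightarrow> Z \<in> borel_measurable M \<and> integrable M (\<lambda>\<omega>. (Z \<omega>)\<^sup>2) \<and>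
     (\<integral>\<omega>. cos (Z \<omega>) \<partial>M) = exp (- (\<integral>\<omega>. (Z \<omega>)\<^sup>2 \<partial>M) / 2)"

lemma std_normal_cos_integral:
  "(\<integral>x. std_normal_density x * cos (u * x) \<partial>lborel) = exp (- (u\<^sup>2) / 2)"
proof -
  have "char std_normal_distribution u = (\<integral>x. std_normal_density x *\<^sub>R iexp (u * x) \<partial>lborel)"
    unfolding char_def by (subst integral_density) (auto simp: normal_density_nonneg)
  then have "(\<integral>x. std_normal_density x *\<^sub>R iexp (u * x) \<partial>lborel) = complex_of_real (exp (- (u\<^sup>2) / 2))"
    by (simp only: char_std_normal_distribution)
  then have "Re (\<integral>x. std_normal_density x *\<^sub>R iexp (u * x) \<partial>lborel) = exp (- (u\<^sup>2) / 2)"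
    by (simp only: Re_complex_of_real)
  moreover have "Re (\<integral>x. std_normal_density x *\<^sub>R iexp (u * x) \<partial>lborel)
      = (\<integral>x. Re (std_normal_density x *\<^sub>R iexp (u * x)) \<partial>lborel)"
  proof (rule integral_Re[symmetric])
    show "integrable lborel (\<lambda>x. std_normal_density x *\<^sub>R iexp (u * x))"
      by (rule Bochner_Integration.integrable_bound[OF integrable_normal_density[of 1 0]])
        (auto simp: norm_mult)
  qed
  ultimately show ?thesis by (simp add: Re_exp)
qed

context prob_space
begin

lemma normal_gaussian_like:
  assumes "\<sigma> > 0" "distributed M lborel X (\<lambda>x. ennreal (normal_density 0 \<sigma> x))"
  shows "gaussian_like M X"
proof -
  have X[measurable]: "X \<in> borel_measurable M"
    using distributed_measurable[OF assms(2)] by simp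
  have E: "expectation X = 0" by (rule normal_distributed_expectation[OF assms])
  then have V: "expectation (\<lambda>\<omega>. (X \<omega>)\<^sup>2) = \<sigma>\<^sup>2"
    using normal_distributed_variance[OF assms] by simp
  \<comment> \<open>The integral of a nonintegrable function is 0 by default, but the second moment
    equals \<sigma>^2 > 0.\<close>
  then have "integrable M (\<lambda>\<omega>. (X \<omega>)\<^sup>2)"
    using assms(1) not_integrable_integral_eq[of M "\<lambda>\<omega>. (X \<omega>)\<^sup>2"] by fastforce
  moreover have "expectation (\<lambda>\<omega>. cos (X \<omega>)) = exp (- (\<sigma>\<^sup>2) / 2)"
  proof -
    have "distributed M lborel (\<lambda>x. (X x - 0) / \<sigma>) std_normal_density"
      using assms(2) by (subst (asm) normal_standard_normal_convert[OF assms(1)])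
    from distributed_integral[OF this, of "\<lambda>x. cos (\<sigma> * x)"]
    have "(\<integral>x. std_normal_density x * cos (\<sigma> * x) \<partial>lborel) = expectation (\<lambda>\<omega>. cos (X \<omega>))"
      using assms(1) by simp
    then show ?thesis by (simp add: std_normal_cos_integral)
  qed
  ultimately show ?thesis unfolding gaussian_like_def V using X by simp
qed

lemma centered_gaussian_process_linear_combination:
  assumes "centered_gaussian_process M I X" "linear_combination I X Z"
  shows "gaussian_like M Z"
proof -
  obtain F c where F: "finite F" "F \<subseteq> I" "Z = (\<lambda>\<omega>. \<Sum>k\<in>F. c k * X k \<omega>)"
    using assms(2) unfolding linear_combination_def by blast
  have Z[measurable]: "Z \<in> borel_measurable M"
    using assms(1) F unfolding F(3) centered_gaussian_process_def
    by (intro borel_measurable_sum borel_measurable_times) auto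
  from assms(1) F consider "AE \<omega> in M. Z \<omega> = 0"
    | \<sigma> where "\<sigma> > 0" "distributed M lborel Z (\<lambda>x. ennreal (normal_density 0 \<sigma> x))"
    unfolding centered_gaussian_process_def F(3) by blast
  then show ?thesis
  proof cases
    case 1
    have "expectation (\<lambda>\<omega>. (Z \<omega>)\<^sup>2) = 0"
      by (rule integral_eq_zero_AE) (use 1 in auto)
    moreover have "integrable M (\<lambda>\<omega>. (Z \<omega>)\<^sup>2) \<longleftrightarrow> integrable M (\<lambda>\<omega>. 0 :: real)"
      by (rule integrable_cong_AE) (use 1 in auto)
    moreover have "expectation (\<lambda>\<omega>. cos (Z \<omega>)) = expectation (\<lambda>\<omega>. 1)"
      by (rule integral_cong_AE) (use 1 in auto)
    ultimately show ?thesis unfolding gaussian_like_def by (simp add: prob_space)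
  qed (rule normal_gaussian_like)
qed

lemma centered_gaussian_process_expectation:
  assumes "centered_gaussian_process M I X" "linear_combination I X Z"
  shows "expectation Z = 0"
proof -
  from assms consider "AE \<omega> in M. Z \<omega> = 0"
    | \<sigma> where "\<sigma> > 0" "distributed M lborel Z (\<lambda>x. ennreal (normal_density 0 \<sigma> x))"
    unfolding centered_gaussian_process_def linear_combination_def by blast
  then show ?thesis
    by cases (auto intro: integral_eq_zero_AE normal_distributed_expectation)
qed

section \<open>Square integrable variables: products, sums and the Cauchy-Schwarz inequality\<close>

lemma square_integrable_mult:
  fixes f g :: "'a \<Rightarrow> real"
  assumes [measurable]: "f \<in> borel_measurable M" "g \<in> borel_measurable M"
    and "integrable M (\<lambda>\<omega>. (f \<omega>)\<^sup>2)" "integrable M (\<lambda>\<omega>. (g \<omega>)\<^sup>2)"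
  shows "integrable M (\<lambda>\<omega>. f \<omega> * g \<omega>)"
proof (rule Bochner_Integration.integrable_bound)
  show "integrable M (\<lambda>\<omega>. (f \<omega>)\<^sup>2 + (g \<omega>)\<^sup>2)" using assms by simp
  have "\<bar>a * b\<bar> \<le> a\<^sup>2 + b\<^sup>2" for a b :: real
  proof -
    have "2 * \<bar>a\<bar> * \<bar>b\<bar> \<le> \<bar>a\<bar>\<^sup>2 + \<bar>b\<bar>\<^sup>2" by (rule sum_squares_bound)
    moreover have "0 \<le> \<bar>a\<bar> * \<bar>b\<bar>" by simp
    ultimately show ?thesis by (simp only: abs_mult power2_abs mult.assoc)
  qed
  then show "AE \<omega> in M. norm (f \<omega> * g \<omega>) \<le> norm ((f \<omega>)\<^sup>2 + (g \<omega>)\<^sup>2)" by simp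
qed simp

lemma square_integrable_add:
  fixes f g :: "'a \<Rightarrow> real"
  assumes [measurable]: "f \<in> borel_measurable M" "g \<in> borel_measurable M"
    and "integrable M (\<lambda>\<omega>. (f \<omega>)\<^sup>2)" "integrable M (\<lambda>\<omega>. (g \<omega>)\<^sup>2)"
  shows "integrable M (\<lambda>\<omega>. (f \<omega> + g \<omega>)\<^sup>2)"
  using assms square_integrable_mult[OF assms] by (simp add: power2_sum mult.assoc)

lemma Cauchy_Schwarz_expectation:
  fixes f g :: "'a \<Rightarrow> real"
  assumes [measurable]: "f \<in> borel_measurable M" "g \<in> borel_measurable M"
    and "integrable M (\<lambda>\<omega>. (f \<omega>)\<^sup>2)" "integrable M (\<lambda>\<omega>. (g \<omega>)\<^sup>2)"
  shows "\<bar>expectation (\<lambda>\<omega>. f \<omega> * g \<omega>)\<bar>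
     \<le> sqrt (expectation (\<lambda>\<omega>. (f \<omega>)\<^sup>2)) * sqrt (expectation (\<lambda>\<omega>. (g \<omega>)\<^sup>2))"
proof -
  define A where "A = expectation (\<lambda>\<omega>. (f \<omega>)\<^sup>2)"
  define B where "B = expectation (\<lambda>\<omega>. (g \<omega>)\<^sup>2)"
  define C where "C = expectation (\<lambda>\<omega>. f \<omega> * g \<omega>)"
  note fg = square_integrable_mult[OF assms]
  have quad: "0 \<le> A - 2 * t * C + t\<^sup>2 * B" for t
  proof -
    have "0 \<le> expectation (\<lambda>\<omega>. (f \<omega> - t * g \<omega>)\<^sup>2)" by simp
    also have "\<dots> = expectation (\<lambda>\<omega>. (f \<omega>)\<^sup>2 - 2 * t * (f \<omega> * g \<omega>) + t\<^sup>2 * (g \<omega>)\<^sup>2)"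
      by (intro Bochner_Integration.integral_cong) (auto simp: power2_eq_square algebra_simps)
    also have "\<dots> = A - 2 * t * C + t\<^sup>2 * B"
      unfolding A_def B_def C_def using assms fg by simp
    finally show ?thesis .
  qed
  have "C\<^sup>2 \<le> A * B"
  proof (cases "B = 0")
    case True
    \<comment> \<open>With B = 0 and C nonzero, this t would make the quadratic form equal to A - (A
      + 1) = -1.\<close>
    then have "C = 0" using quad[of "(A + 1) / (2 * C)"] by (auto split: if_splits)
    with True show ?thesis by simp
  next
    case False
    have "B \<ge> 0" by (simp add: B_def)
    with False have "B > 0" by simp
    with quad[of "C / B"] show ?thesis by (simp add: power2_eq_square field_simps)
  qed
  then have "(expectation (\<lambda>\<omega>. f \<omega> * g \<omega>))\<^sup>2 \<le> expectation (\<lambda>\<omega>. (f \<omega>)\<^sup>2) * expectation (\<lambda>\<omega>. (g \<omega>)\<^sup>2)"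
    by (simp add: A_def B_def C_def)
  then have "sqrt ((expectation (\<lambda>\<omega>. f \<omega> * g \<omega>))\<^sup>2)
      \<le> sqrt (expectation (\<lambda>\<omega>. (f \<omega>)\<^sup>2) * expectation (\<lambda>\<omega>. (g \<omega>)\<^sup>2))"
    by (rule real_sqrt_le_mono)
  then show ?thesis by (simp add: real_sqrt_mult)
qed

text \<open>By the half-angle formula this is the squared form of |sin (a - b)| \<le> |sin a| + |sin
  b|. It makes E[1 - cos (X - Y)] a bounded substitute for E[(X - Y)^2] that obeys a triangle
  inequality up to a constant.\<close>

lemma one_minus_cos_diff_le:
  fixes x y :: real
  shows "1 - cos (x - y) \<le> 2 * (1 - cos x) + 2 * (1 - cos y)"
proof -
  have half: "1 - cos z = 2 * (sin (z / 2))\<^sup>2" for z :: real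
    using cos_double_sin[of "z / 2"] by simp
  have "\<bar>sin (x / 2 - y / 2)\<bar> \<le> \<bar>sin (x / 2)\<bar> + \<bar>sin (y / 2)\<bar>"
  proof -
    have "\<bar>sin (x / 2) * cos (y / 2)\<bar> \<le> \<bar>sin (x / 2)\<bar>" "\<bar>cos (x / 2) * sin (y / 2)\<bar> \<le> \<bar>sin (y / 2)\<bar>"
      by (simp_all add: abs_mult mult_left_le mult_left_le_one_le)
    then show ?thesis by (simp add: sin_diff)
  qed
  then have "\<bar>sin (x / 2 - y / 2)\<bar>\<^sup>2 \<le> (\<bar>sin (x / 2)\<bar> + \<bar>sin (y / 2)\<bar>)\<^sup>2"
    by (intro power_mono) auto
  also have "\<dots> \<le> 2 * \<bar>sin (x / 2)\<bar>\<^sup>2 + 2 * \<bar>sin (y / 2)\<bar>\<^sup>2"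
    using sum_squares_bound[of "\<bar>sin (x / 2)\<bar>" "\<bar>sin (y / 2)\<bar>"] by (simp add: power2_sum)
  finally show ?thesis
    unfolding half by (simp add: diff_divide_distrib)
qed

text \<open>Dominated convergence gives e n = E[1 - cos (X n - Y)] \<longlonglongrightarrow> 0 with
  no moment assumption on Y. For the differences X n - X m the same quantity is 1 - exp (- v / 2),
  with v their second moment, so smallness of e forces smallness of v: the sequence is Cauchy in L2,
  and Fatou's lemma carries the bound over to Y.\<close>

lemma gaussian_like_AE_limit_L2:
  fixes X :: "nat \<Rightarrow> 'a \<Rightarrow> real"
  assumes diff: "\<And>n m. gaussian_like M (\<lambda>\<omega>. X n \<omega> - X m \<omega>)"
    and [measurable]: "\<And>n. X n \<in> borel_measurable M" "Y \<in> borel_measurable M"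
    and lim: "AE \<omega> in M. (\<lambda>n. X n \<omega>) \<longlonglongrightarrow> Y \<omega>"
  shows "\<forall>\<^sub>F n in sequentially. integrable M (\<lambda>\<omega>. (X n \<omega> - Y \<omega>)\<^sup>2)" (is ?A)
    and "(\<lambda>n. expectation (\<lambda>\<omega>. (X n \<omega> - Y \<omega>)\<^sup>2)) \<longlonglongrightarrow> 0" (is ?B)
proof -
  define e where "e n = expectation (\<lambda>\<omega>. 1 - cos (X n \<omega> - Y \<omega>))" for n
  have "e \<longlonglongrightarrow> expectation (\<lambda>\<omega>. 1 - cos (0::real))"
    unfolding e_def
  proof (rule integral_dominated_convergence)
    show "AE \<omega> in M. (\<lambda>n. 1 - cos (X n \<omega> - Y \<omega>)) \<longlonglongrightarrow> 1 - cos 0"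
      using lim by eventually_elim (auto intro!: tendsto_eq_intros)
    show "AE \<omega> in M. norm (1 - cos (X n \<omega> - Y \<omega>)) \<le> 2" for n
      by (rule AE_I2) (use cos_ge_minus_one cos_le_one in \<open>smt (verit) real_norm_def\<close>)
  qed auto
  then have e0: "e \<longlonglongrightarrow> 0" by simp
  define v where "v n m = expectation (\<lambda>\<omega>. (X n \<omega> - X m \<omega>)\<^sup>2)" for n m
  have v: "1 - exp (- v n m / 2) \<le> 2 * e n + 2 * e m" for n m
  proof -
    have bd: "integrable M (\<lambda>\<omega>. cos (X n \<omega> - Y \<omega>))" "integrable M (\<lambda>\<omega>. cos (X n \<omega> - X m \<omega>))" for n m
      by (rule integrable_const_bound[of _ 1]; simp)+
    have "1 - exp (- v n m / 2) = expectation (\<lambda>\<omega>. 1 - cos (X n \<omega> - X m \<omega>))"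
      using diff[of n m] bd by (simp add: gaussian_like_def v_def prob_space)
    also have "\<dots> \<le> expectation (\<lambda>\<omega>. 2 * (1 - cos (X n \<omega> - Y \<omega>)) + 2 * (1 - cos (X m \<omega> - Y \<omega>)))"
    proof (rule integral_mono)
      show "1 - cos (X n \<omega> - X m \<omega>) \<le> 2 * (1 - cos (X n \<omega> - Y \<omega>)) + 2 * (1 - cos (X m \<omega> - Y \<omega>))" for \<omega>
        using one_minus_cos_diff_le[of "X n \<omega> - Y \<omega>" "X m \<omega> - Y \<omega>"] by simp
    qed (use bd in auto)
    also have "\<dots> = 2 * e n + 2 * e m"
      unfolding e_def using bd by simp
    finally show ?thesis .
  qed
  have main: "\<exists>N. \<forall>n\<ge>N. integrable M (\<lambda>\<omega>. (X n \<omega> - Y \<omega>)\<^sup>2) \<and> expectation (\<lambda>\<omega>. (X n \<omega> - Y \<omega>)\<^sup>2) \<le> r"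
    if "r > 0" for r
  proof -
    \<comment> \<open>\<open>q\<close> is the value of 1 - exp (- v / 2) at v = r. With e n and e m
      below q / 4, the bound 2 e n + 2 e m stays below \<open>q\<close>, which means v < r.\<close>
    define q where "q = 1 - exp (- r / 2)"
    have "\<forall>\<^sub>F n in sequentially. e n < q / 4"
      by (rule order_tendstoD[OF e0]) (use that in \<open>simp add: q_def\<close>)
    then obtain N where N: "\<And>n. n \<ge> N \<Longrightarrow> e n < q / 4"
      unfolding eventually_sequentially by blast
    have vr: "v n m \<le> r" if "n \<ge> N" "m \<ge> N" for n m
    proof -
      have "1 - exp (- v n m / 2) < q"
        using v[of n m] N[OF that(1)] N[OF that(2)] by linarith
      then show ?thesis by (simp add: q_def)
    qed
    have "integrable M (\<lambda>\<omega>. (X n \<omega> - Y \<omega>)\<^sup>2) \<and> expectation (\<lambda>\<omega>. (X n \<omega> - Y \<omega>)\<^sup>2) \<le> r" if n: "n \<ge> N" for n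
    proof -
      \<comment> \<open>Fatou's lemma in m with n fixed: the integrand is the almost sure limit of
        (X n - X m)^2, whose integrals are at most r once m \<ge> N.\<close>
      have "(\<integral>\<^sup>+\<omega>. ennreal ((X n \<omega> - Y \<omega>)\<^sup>2) \<partial>M)
          = (\<integral>\<^sup>+\<omega>. liminf (\<lambda>m. ennreal ((X n \<omega> - X m \<omega>)\<^sup>2)) \<partial>M)"
      proof (rule nn_integral_cong_AE)
        show "AE \<omega> in M. ennreal ((X n \<omega> - Y \<omega>)\<^sup>2) = liminf (\<lambda>m. ennreal ((X n \<omega> - X m \<omega>)\<^sup>2))"
          using lim
        proof eventually_elim
          case (elim \<omega>)
          then have "(\<lambda>m. ennreal ((X n \<omega> - X m \<omega>)\<^sup>2)) \<longlonglongrightarrow> ennreal ((X n \<omega> - Y \<omega>)\<^sup>2)"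
            by (intro tendsto_intros)
          then show ?case by (intro lim_imp_Liminf[symmetric]) auto
        qed
      qed
      also have "\<dots> \<le> liminf (\<lambda>m. \<integral>\<^sup>+\<omega>. ennreal ((X n \<omega> - X m \<omega>)\<^sup>2) \<partial>M)"
        by (rule nn_integral_liminf) simp
      also have "\<dots> \<le> ennreal r"
      proof (rule Liminf_le)
        show "\<forall>\<^sub>F m in sequentially. (\<integral>\<^sup>+\<omega>. ennreal ((X n \<omega> - X m \<omega>)\<^sup>2) \<partial>M) \<le> ennreal r"
          using eventually_ge_at_top[of N]
        proof eventually_elim
          case (elim m)
          have "(\<integral>\<^sup>+\<omega>. ennreal ((X n \<omega> - X m \<omega>)\<^sup>2) \<partial>M) = ennreal (v n m)"
            unfolding v_def using diff[of n m]
            by (intro nn_integral_eq_integral) (auto simp: gaussian_like_def)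
          then show ?case using vr[OF n elim] by (simp add: ennreal_leI)
        qed
      qed simp
      finally have le: "(\<integral>\<^sup>+\<omega>. ennreal ((X n \<omega> - Y \<omega>)\<^sup>2) \<partial>M) \<le> ennreal r" .
      have int: "integrable M (\<lambda>\<omega>. (X n \<omega> - Y \<omega>)\<^sup>2)"
        by (rule integrableI_nonneg) (use le in \<open>auto simp: le_less_trans\<close>)
      have "ennreal (expectation (\<lambda>\<omega>. (X n \<omega> - Y \<omega>)\<^sup>2)) \<le> ennreal r"
        using le nn_integral_eq_integral[OF int] by simp
      then show ?thesis using int that \<open>r > 0\<close> by (simp add: ennreal_le_iff)
    qed
    then show ?thesis by blast
  qed
  show ?A using main[of 1] unfolding eventually_sequentially by auto
  show ?B
  proof (rule LIMSEQ_I)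
    fix r :: real assume "r > 0"
    then obtain N where N: "\<forall>n\<ge>N. expectation (\<lambda>\<omega>. (X n \<omega> - Y \<omega>)\<^sup>2) \<le> r / 2"
      using main[of "r / 2"] by auto
    have "norm (expectation (\<lambda>\<omega>. (X n \<omega> - Y \<omega>)\<^sup>2) - 0) < r" if "n \<ge> N" for n
    proof -
      have "expectation (\<lambda>\<omega>. (X n \<omega> - Y \<omega>)\<^sup>2) \<ge> 0" by simp
      then show ?thesis using N[rule_format, OF that] \<open>r > 0\<close> by simp
    qed
    then show "\<exists>no. \<forall>n\<ge>no. norm (expectation (\<lambda>\<omega>. (X n \<omega> - Y \<omega>)\<^sup>2) - 0) < r" by blast
  qed
qed

lemma AE_limit_L2_square_integrable:
  fixes X :: "nat \<Rightarrow> 'a \<Rightarrow> real"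
  assumes "\<forall>\<^sub>F n in sequentially. integrable M (\<lambda>\<omega>. (X n \<omega> - Y \<omega>)\<^sup>2)"
    and [measurable]: "\<And>n. X n \<in> borel_measurable M" "Y \<in> borel_measurable M"
    and X2: "\<And>n. integrable M (\<lambda>\<omega>. (X n \<omega>)\<^sup>2)"
  shows "integrable M (\<lambda>\<omega>. (Y \<omega>)\<^sup>2)"
proof -
  obtain n where n: "integrable M (\<lambda>\<omega>. (X n \<omega> - Y \<omega>)\<^sup>2)"
    using assms(1) unfolding eventually_sequentially by blast
  have "integrable M (\<lambda>\<omega>. (Y \<omega> - X n \<omega>)\<^sup>2)" using n by (simp add: power2_commute)
  then have "integrable M (\<lambda>\<omega>. ((Y \<omega> - X n \<omega>) + X n \<omega>)\<^sup>2)"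
    by (intro square_integrable_add X2) auto
  then show ?thesis by simp
qed

lemma L2_limit_expectation_mult:
  fixes X :: "nat \<Rightarrow> 'a \<Rightarrow> real"
  assumes "\<forall>\<^sub>F n in sequentially. integrable M (\<lambda>\<omega>. (X n \<omega> - Y \<omega>)\<^sup>2)"
    and lim: "(\<lambda>n. expectation (\<lambda>\<omega>. (X n \<omega> - Y \<omega>)\<^sup>2)) \<longlonglongrightarrow> 0"
    and [measurable]: "\<And>n. X n \<in> borel_measurable M" "Y \<in> borel_measurable M" "Z \<in> borel_measurable M"
    and X2: "\<And>n. integrable M (\<lambda>\<omega>. (X n \<omega>)\<^sup>2)"
    and Z2: "integrable M (\<lambda>\<omega>. (Z \<omega>)\<^sup>2)"
  shows "(\<lambda>n. expectation (\<lambda>\<omega>. Z \<omega> * X n \<omega>)) \<longlonglongrightarrow> expectation (\<lambda>\<omega>. Z \<omega> * Y \<omega>)"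
proof -
  have Y2: "integrable M (\<lambda>\<omega>. (Y \<omega>)\<^sup>2)"
    by (rule AE_limit_L2_square_integrable[OF assms(1)]) (use X2 in auto)
  have ZX: "integrable M (\<lambda>\<omega>. Z \<omega> * X n \<omega>)" for n by (rule square_integrable_mult) (use X2 Z2 in auto)
  have ZY: "integrable M (\<lambda>\<omega>. Z \<omega> * Y \<omega>)" by (rule square_integrable_mult) (use Y2 Z2 in auto)
  have "(\<lambda>n. expectation (\<lambda>\<omega>. Z \<omega> * X n \<omega>) - expectation (\<lambda>\<omega>. Z \<omega> * Y \<omega>)) \<longlonglongrightarrow> 0"
  proof (rule Lim_null_comparison)
    show "\<forall>\<^sub>F n in sequentially. norm (expectation (\<lambda>\<omega>. Z \<omega> * X n \<omega>) - expectation (\<lambda>\<omega>. Z \<omega> * Y \<omega>))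
        \<le> sqrt (expectation (\<lambda>\<omega>. (Z \<omega>)\<^sup>2)) * sqrt (expectation (\<lambda>\<omega>. (X n \<omega> - Y \<omega>)\<^sup>2))"
      using assms(1)
    proof eventually_elim
      case (elim n)
      have "expectation (\<lambda>\<omega>. Z \<omega> * X n \<omega>) - expectation (\<lambda>\<omega>. Z \<omega> * Y \<omega>)
          = expectation (\<lambda>\<omega>. Z \<omega> * (X n \<omega> - Y \<omega>))"
        using ZX ZY by (simp add: right_diff_distrib)
      then show ?case using Cauchy_Schwarz_expectation[of Z "\<lambda>\<omega>. X n \<omega> - Y \<omega>"] Z2 elim by simp
    qed
    have "(\<lambda>n. sqrt (expectation (\<lambda>\<omega>. (Z \<omega>)\<^sup>2)) * sqrt (expectation (\<lambda>\<omega>. (X n \<omega> - Y \<omega>)\<^sup>2)))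
        \<longlonglongrightarrow> sqrt (expectation (\<lambda>\<omega>. (Z \<omega>)\<^sup>2)) * sqrt 0"
      by (intro tendsto_intros lim)
    then show "(\<lambda>n. sqrt (expectation (\<lambda>\<omega>. (Z \<omega>)\<^sup>2)) * sqrt (expectation (\<lambda>\<omega>. (X n \<omega> - Y \<omega>)\<^sup>2))) \<longlonglongrightarrow> 0"
      by simp
  qed
  then show ?thesis by (rule LIM_zero_cancel)
qed

text \<open>Rests on E[X^2] = E[(X - Y)^2] + 2 E[Y X] - E[Y^2], where the mixed moment converges by
  the preceding lemma with Z = Y.\<close>

lemma L2_limit_expectation_square:
  fixes X :: "nat \<Rightarrow> 'a \<Rightarrow> real"
  assumes ev: "\<forall>\<^sub>F n in sequentially. integrable M (\<lambda>\<omega>. (X n \<omega> - Y \<omega>)\<^sup>2)"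
    and lim: "(\<lambda>n. expectation (\<lambda>\<omega>. (X n \<omega> - Y \<omega>)\<^sup>2)) \<longlonglongrightarrow> 0"
    and [measurable]: "\<And>n. X n \<in> borel_measurable M" "Y \<in> borel_measurable M"
    and X2: "\<And>n. integrable M (\<lambda>\<omega>. (X n \<omega>)\<^sup>2)"
  shows "(\<lambda>n. expectation (\<lambda>\<omega>. (X n \<omega>)\<^sup>2)) \<longlonglongrightarrow> expectation (\<lambda>\<omega>. (Y \<omega>)\<^sup>2)"
proof -
  have Y2: "integrable M (\<lambda>\<omega>. (Y \<omega>)\<^sup>2)"
    by (rule AE_limit_L2_square_integrable[OF assms(1)]) (use X2 in auto)
  have "(\<lambda>n. expectation (\<lambda>\<omega>. Y \<omega> * X n \<omega>)) \<longlonglongrightarrow> expectation (\<lambda>\<omega>. Y \<omega> * Y \<omega>)"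
    by (rule L2_limit_expectation_mult[OF ev lim]) (use X2 Y2 in auto)
  then have "(\<lambda>n. expectation (\<lambda>\<omega>. (X n \<omega> - Y \<omega>)\<^sup>2) + 2 * expectation (\<lambda>\<omega>. Y \<omega> * X n \<omega>)
       - expectation (\<lambda>\<omega>. (Y \<omega>)\<^sup>2)) \<longlonglongrightarrow> 0 + 2 * expectation (\<lambda>\<omega>. Y \<omega> * Y \<omega>) - expectation (\<lambda>\<omega>. (Y \<omega>)\<^sup>2)"
    by (intro tendsto_intros lim)
  moreover have "expectation (\<lambda>\<omega>. (X n \<omega> - Y \<omega>)\<^sup>2) + 2 * expectation (\<lambda>\<omega>. Y \<omega> * X n \<omega>)
       - expectation (\<lambda>\<omega>. (Y \<omega>)\<^sup>2) = expectation (\<lambda>\<omega>. (X n \<omega>)\<^sup>2)" for n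
  proof -
    have "integrable M (\<lambda>\<omega>. Y \<omega> * X n \<omega>)" by (rule square_integrable_mult) (use X2 Y2 in auto)
    moreover have "expectation (\<lambda>\<omega>. (X n \<omega> - Y \<omega>)\<^sup>2)
        = expectation (\<lambda>\<omega>. (X n \<omega>)\<^sup>2 + (Y \<omega>)\<^sup>2 - 2 * (Y \<omega> * X n \<omega>))"
      by (simp add: power2_diff mult.commute mult.left_commute)
    ultimately show ?thesis using X2[of n] Y2 by simp
  qed
  ultimately show ?thesis by (simp add: power2_eq_square)
qed

text \<open>Closure under almost sure limits: the cosine side converges because cosine is bounded,
  the second moment by L2 convergence. It is needed because the inner limit of an iterated limit
  must again qualify as a sequence for the outer one.\<close>

lemma gaussian_like_AE_limit:
  fixes X :: "nat \<Rightarrow> 'a \<Rightarrow> real"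
  assumes X: "\<And>n. gaussian_like M (X n)"
    and diff: "\<And>n m. gaussian_like M (\<lambda>\<omega>. X n \<omega> - X m \<omega>)"
    and Y[measurable]: "Y \<in> borel_measurable M"
    and lim: "AE \<omega> in M. (\<lambda>n. X n \<omega>) \<longlonglongrightarrow> Y \<omega>"
  shows "gaussian_like M Y"
proof -
  have Xm[measurable]: "\<And>n. X n \<in> borel_measurable M" and X2: "\<And>n. integrable M (\<lambda>\<omega>. (X n \<omega>)\<^sup>2)"
    using X by (auto simp: gaussian_like_def)
  note L2 = gaussian_like_AE_limit_L2[OF diff Xm Y lim]
  have "(\<lambda>n. expectation (\<lambda>\<omega>. cos (X n \<omega>))) \<longlonglongrightarrow> expectation (\<lambda>\<omega>. cos (Y \<omega>))"
    by (rule integral_dominated_convergence[where w = "\<lambda>_. 1"])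
      (use lim in \<open>auto elim!: eventually_mono intro!: tendsto_cos\<close>)
  moreover have "(\<lambda>n. expectation (\<lambda>\<omega>. cos (X n \<omega>))) \<longlonglongrightarrow> exp (- expectation (\<lambda>\<omega>. (Y \<omega>)\<^sup>2) / 2)"
    using X by (auto simp: gaussian_like_def intro!: tendsto_intros L2_limit_expectation_square[OF L2] X2)
  ultimately have "expectation (\<lambda>\<omega>. cos (Y \<omega>)) = exp (- expectation (\<lambda>\<omega>. (Y \<omega>)\<^sup>2) / 2)"
    by (rule LIMSEQ_unique)
  with AE_limit_L2_square_integrable[OF L2(1) Xm Y X2] show ?thesis by (simp add: gaussian_like_def)
qed

text \<open>Meant for integrals over a half-line: n refines the partition and m moves the lower end
  to minus infinity. Both limits are upgraded to L2, where pairing with Z is continuous, so E[Z Y]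
  is computed from the moments of the sums alone.\<close>

lemma iterated_limit_expectation_mult:
  fixes S :: "nat \<Rightarrow> nat \<Rightarrow> 'a \<Rightarrow> real"
  assumes gp: "centered_gaussian_process M I X"
    and S: "\<And>m n. linear_combination I X (S m n)"
    and Y[measurable]: "Y \<in> borel_measurable M"
    and lim: "AE \<omega> in M. \<exists>J. (\<forall>m. (\<lambda>n. S m n \<omega>) \<longlonglongrightarrow> J m) \<and> J \<longlonglongrightarrow> Y \<omega>"
    and Z[measurable]: "Z \<in> borel_measurable M" and Z2: "integrable M (\<lambda>\<omega>. (Z \<omega>)\<^sup>2)"
    and e: "\<And>m. (\<lambda>n. expectation (\<lambda>\<omega>. Z \<omega> * S m n \<omega>)) \<longlonglongrightarrow> e m" and l: "e \<longlonglongrightarrow> l"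
  shows "expectation (\<lambda>\<omega>. Z \<omega> * Y \<omega>) = l" and "integrable M (\<lambda>\<omega>. (Y \<omega>)\<^sup>2)"
proof -
  note gl = centered_gaussian_process_linear_combination[OF gp]
  have Sm[measurable]: "\<And>m n. S m n \<in> borel_measurable M" and S2: "\<And>m n. integrable M (\<lambda>\<omega>. (S m n \<omega>)\<^sup>2)"
    using gl[OF S] by (auto simp: gaussian_like_def)
  \<comment> \<open>The hypothesis provides inner limits only pointwise, for each sample point;
    \<open>lim\<close> selects a measurable version of them.\<close>
  define J where "J m \<omega> = lim (\<lambda>n. S m n \<omega>)" for m \<omega>
  have Jm[measurable]: "\<And>m. J m \<in> borel_measurable M"
    unfolding J_def by (rule borel_measurable_lim_metric) simp
  have lim': "AE \<omega> in M. (\<forall>m. (\<lambda>n. S m n \<omega>) \<longlonglongrightarrow> J m \<omega>) \<and> (\<lambda>m. J m \<omega>) \<longlonglongrightarrow> Y \<omega>"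
    using lim
  proof eventually_elim
    case (elim \<omega>)
    then obtain J' where J': "\<And>m. (\<lambda>n. S m n \<omega>) \<longlonglongrightarrow> J' m" "J' \<longlonglongrightarrow> Y \<omega>" by blast
    then have "J m \<omega> = J' m" for m unfolding J_def by (intro limI)
    with J' show ?case by simp
  qed
  have SJ: "AE \<omega> in M. (\<lambda>n. S m n \<omega>) \<longlonglongrightarrow> J m \<omega>" for m using lim' by auto
  have JY: "AE \<omega> in M. (\<lambda>m. J m \<omega>) \<longlonglongrightarrow> Y \<omega>" using lim' by auto
  have Jg: "gaussian_like M (J m)" for m
    by (rule gaussian_like_AE_limit[OF gl[OF S] gl[OF linear_combination_diff[OF S S]] Jm SJ])
  have Jd: "gaussian_like M (\<lambda>\<omega>. J m \<omega> - J m' \<omega>)" for m m'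
  proof (rule gaussian_like_AE_limit[where X = "\<lambda>n \<omega>. S m n \<omega> - S m' n \<omega>"])
    show "AE \<omega> in M. (\<lambda>n. S m n \<omega> - S m' n \<omega>) \<longlonglongrightarrow> J m \<omega> - J m' \<omega>"
      using lim' by eventually_elim (auto intro: tendsto_diff)
  qed (auto intro!: gl linear_combination_diff S)
  have J2: "integrable M (\<lambda>\<omega>. (J m \<omega>)\<^sup>2)" for m using Jg by (simp add: gaussian_like_def)
  note L2 = gaussian_like_AE_limit_L2[OF Jd Jm Y JY]
  have "(\<lambda>m. expectation (\<lambda>\<omega>. Z \<omega> * J m \<omega>)) \<longlonglongrightarrow> expectation (\<lambda>\<omega>. Z \<omega> * Y \<omega>)"
    by (rule L2_limit_expectation_mult[OF L2 Jm Y Z J2 Z2])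
  moreover have "expectation (\<lambda>\<omega>. Z \<omega> * J m \<omega>) = e m" for m
  proof (rule LIMSEQ_unique[OF _ e])
    show "(\<lambda>n. expectation (\<lambda>\<omega>. Z \<omega> * S m n \<omega>)) \<longlonglongrightarrow> expectation (\<lambda>\<omega>. Z \<omega> * J m \<omega>)"
      by (rule L2_limit_expectation_mult[OF gaussian_like_AE_limit_L2[OF gl[OF linear_combination_diff[OF S S]] Sm Jm SJ] Sm Jm Z S2 Z2])
  qed
  ultimately show "expectation (\<lambda>\<omega>. Z \<omega> * Y \<omega>) = l" using l LIMSEQ_unique by auto
  show "integrable M (\<lambda>\<omega>. (Y \<omega>)\<^sup>2)" by (rule AE_limit_L2_square_integrable[OF L2(1) Jm Y J2])
qed

end

section \<open>Moments of the fractional Ornstein--Uhlenbeck process\<close>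

text \<open>Fatou's lemma and dominated convergence work along sequences, so the mesh limit is
  restricted to one sequence of partitions: equal cells with left tags, as in
  \<open>riemann_stieltjes_sum_limit\<close>. Taking \<open>Suc n\<close> cells avoids a division by
  0.\<close>

lemma has_RS_integral_uniform_sums:
  assumes "has_RS_integral f g a b J"
  defines "x \<equiv> \<lambda>n k. a + real k * ((b - a) / real (Suc n))"
  shows "(\<lambda>n. \<Sum>k<Suc n. f (x n k) * (g (x n (Suc k)) - g (x n k))) \<longlonglongrightarrow> J"
proof (rule LIMSEQ_I)
  fix r :: real assume "r > 0"
  have ab: "a \<le> b" using assms(1) by (simp add: has_RS_integral_def)
  from assms(1) \<open>r > 0\<close> obtain d where d: "d > 0" and
    close: "\<And>n y \<xi>. y 0 = a \<and> y n = b \<and>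
        (\<forall>k<n. y k \<le> \<xi> k \<and> \<xi> k \<le> y (Suc k) \<and> y (Suc k) - y k < d) \<Longrightarrow>
        \<bar>(\<Sum>k<n. f (\<xi> k) * (g (y (Suc k)) - g (y k))) - J\<bar> < r"
    unfolding has_RS_integral_def by blast
  obtain n0 :: nat where n0: "(b - a) / d < real n0" using reals_Archimedean2 by blast
  have "norm ((\<Sum>k<Suc n. f (x n k) * (g (x n (Suc k)) - g (x n k))) - J) < r" if "n \<ge> n0" for n
  proof -
    define h where "h = (b - a) / real (Suc n)"
    have h0: "h \<ge> 0" using ab by (simp add: h_def)
    have "b - a < d * real n0" using n0 d(1) by (simp add: field_simps)
    also have "\<dots> \<le> d * real (Suc n)" using that d(1) by simp
    finally have hd: "h < d" unfolding h_def using d(1) by (simp add: field_simps)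
    have step: "x n (Suc k) - x n k = h" for k
      by (simp add: x_def h_def distrib_right add_divide_distrib)
    have "x n k \<le> x n (Suc k)" for k using step[of k] h0 by linarith
    moreover have "x n 0 = a" "x n (Suc n) = b" by (simp_all add: x_def)
    ultimately show ?thesis
      unfolding real_norm_def by (intro close) (use step hd in auto)
  qed
  then show "\<exists>no. \<forall>n\<ge>no. norm ((\<Sum>k<Suc n. f (x n k) * (g (x n (Suc k)) - g (x n k))) - J) < r"
    by blast
qed

context prob_space
begin

text \<open>Expectation against Z commutes with the pathwise integral, so E[Z W] is the same
  integral taken against \<phi>. Z is any square integrable variable, jointly Gaussian with B or
  not; this permits both Z = 1 and, in the second integration, Z = an Ornstein-Uhlenbeck
  variable.\<close>

lemma fOU_expectation_mult:
  fixes B :: "real \<Rightarrow> 'a \<Rightarrow> real"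
  assumes gp: "centered_gaussian_process M I X"
    and B: "\<And>u. linear_combination I X (B u)"
    and \<alpha>: "\<alpha> > 0"
    and W[measurable]: "W \<in> borel_measurable M"
    and RS: "AE \<omega> in M. has_RS_integral_from_minus_infinity (\<lambda>s. exp (- \<alpha> * (b - s))) (\<lambda>s. B s \<omega>) b (W \<omega>)"
    and Z[measurable]: "Z \<in> borel_measurable M" and Z2: "integrable M (\<lambda>\<omega>. (Z \<omega>)\<^sup>2)"
    and \<phi>: "\<And>u. expectation (\<lambda>\<omega>. Z \<omega> * B u \<omega>) = \<phi> u"
    and cont: "continuous_on UNIV \<phi>" and quad: "quad_bounded \<phi>" "quad_bounded V"
    and V: "\<And>x. (V has_real_derivative \<phi> x - \<alpha> * V x) (at x)"
  shows "expectation (\<lambda>\<omega>. Z \<omega> * W \<omega>) = \<phi> b - \<alpha> * V b" and "integrable M (\<lambda>\<omega>. (W \<omega>)\<^sup>2)"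
proof -
  define f where "f u = exp (- \<alpha> * (b - u))" for u
  define x where "x m n k = (b - real m) + real k * ((b - (b - real m)) / real (Suc n))" for m n k :: nat
  define S where "S m n \<omega> = (\<Sum>k<Suc n. f (x m n k) * (B (x m n (Suc k)) \<omega> - B (x m n k) \<omega>))" for m n \<omega>
  define e where "e m = (\<phi> b - \<alpha> * V b) - f (b - real m) * (\<phi> (b - real m) - \<alpha> * V (b - real m))" for m
  have lc: "linear_combination I X (S m n)" for m n
    unfolding S_def
    by (intro linear_combination_sum linear_combination_cmult linear_combination_diff B)
  have lim: "AE \<omega> in M. \<exists>J. (\<forall>m. (\<lambda>n. S m n \<omega>) \<longlonglongrightarrow> J m) \<and> J \<longlonglongrightarrow> W \<omega>"
    using RS
  proof eventually_elim
    case (elim \<omega>)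
    then obtain J where J: "\<And>a. a \<le> b \<Longrightarrow> has_RS_integral f (\<lambda>s. B s \<omega>) a b (J a)"
      "(J \<longlongrightarrow> W \<omega>) at_bot"
      unfolding has_RS_integral_from_minus_infinity_def f_def by blast
    have "filterlim (\<lambda>m. b - real m) at_bot sequentially" by real_asymp
    then have "(\<lambda>m. J (b - real m)) \<longlonglongrightarrow> W \<omega>" by (rule filterlim_compose[OF J(2)])
    moreover have "(\<lambda>n. S m n \<omega>) \<longlonglongrightarrow> J (b - real m)" for m
      unfolding S_def x_def by (rule has_RS_integral_uniform_sums) (simp add: J(1))
    ultimately show ?case by (intro exI[of _ "\<lambda>m. J (b - real m)"]) simp
  qed
  have BM: "B u \<in> borel_measurable M" "integrable M (\<lambda>\<omega>. (B u \<omega>)\<^sup>2)" for u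
    using centered_gaussian_process_linear_combination[OF gp B[of u]] by (auto simp: gaussian_like_def)
  have ZB: "integrable M (\<lambda>\<omega>. Z \<omega> * B u \<omega>)" for u
    by (rule square_integrable_mult[OF Z BM(1) Z2 BM(2)])
  have ES: "expectation (\<lambda>\<omega>. Z \<omega> * S m n \<omega>) = (\<Sum>k<Suc n. f (x m n k) * (\<phi> (x m n (Suc k)) - \<phi> (x m n k)))" for m n
  proof -
    have "expectation (\<lambda>\<omega>. Z \<omega> * S m n \<omega>) = expectation (\<lambda>\<omega>. \<Sum>k<Suc n.
        f (x m n k) * (Z \<omega> * B (x m n (Suc k)) \<omega> - Z \<omega> * B (x m n k) \<omega>))"
      unfolding S_def sum_distrib_left
      by (intro Bochner_Integration.integral_cong sum.cong) (simp_all add: algebra_simps)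
    also have "\<dots> = (\<Sum>k<Suc n. expectation (\<lambda>\<omega>.
        f (x m n k) * (Z \<omega> * B (x m n (Suc k)) \<omega> - Z \<omega> * B (x m n k) \<omega>)))"
      by (intro Bochner_Integration.integral_sum Bochner_Integration.integrable_mult_right
          Bochner_Integration.integrable_diff ZB)
    also have "\<dots> = (\<Sum>k<Suc n. f (x m n k) * (\<phi> (x m n (Suc k)) - \<phi> (x m n k)))"
      using ZB by (intro sum.cong refl) (simp add: \<phi>)
    finally show ?thesis .
  qed
  have lim_e: "(\<lambda>n. expectation (\<lambda>\<omega>. Z \<omega> * S m n \<omega>)) \<longlonglongrightarrow> e m" for m
    unfolding ES e_def f_def x_def
    by (rule riemann_stieltjes_sum_limit[OF \<alpha> _ cont V]) simp
  have "((\<lambda>r. exp (- \<alpha> * r) * (\<phi> (b + (- 1) * r) - \<alpha> * V (b + (- 1) * r))) \<longlongrightarrow> 0) at_top"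
    by (rule quad_bounded_exp_tendsto_0[OF _ \<alpha>, of "\<lambda>x. \<phi> x - \<alpha> * V x"])
      (intro quad_bounded_diff quad_bounded_mult_const quad)
  then have "(\<lambda>m. exp (- \<alpha> * real m) * (\<phi> (b + (- 1) * real m) - \<alpha> * V (b + (- 1) * real m))) \<longlonglongrightarrow> 0"
    by (rule filterlim_compose[OF _ filterlim_real_sequentially])
  then have "(\<lambda>m. f (b - real m) * (\<phi> (b - real m) - \<alpha> * V (b - real m))) \<longlonglongrightarrow> 0"
    by (simp add: f_def)
  then have "e \<longlonglongrightarrow> (\<phi> b - \<alpha> * V b) - 0"
    unfolding e_def by (intro tendsto_intros)
  then have l: "e \<longlonglongrightarrow> \<phi> b - \<alpha> * V b" by simp
  show "expectation (\<lambda>\<omega>. Z \<omega> * W \<omega>) = \<phi> b - \<alpha> * V b" "integrable M (\<lambda>\<omega>. (W \<omega>)\<^sup>2)"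
    using iterated_limit_expectation_mult[OF gp lc W lim Z Z2 lim_e l] by auto
qed

text \<open>The case Z = 1, \<phi> = V = 0. Square integrability is recorded so that W may later
  take the place of Z.\<close>

lemma fOU_expectation:
  fixes B :: "real \<Rightarrow> 'a \<Rightarrow> real"
  assumes gp: "centered_gaussian_process M I X"
    and B: "\<And>u. linear_combination I X (B u)"
    and "\<alpha> > 0"
    and W[measurable]: "W \<in> borel_measurable M"
    and RS: "AE \<omega> in M. has_RS_integral_from_minus_infinity (\<lambda>s. exp (- \<alpha> * (b - s))) (\<lambda>s. B s \<omega>) b (W \<omega>)"
  shows "expectation W = 0" and "integrable M (\<lambda>\<omega>. (W \<omega>)\<^sup>2)"
proof -
  note * = fOU_expectation_mult[OF assms, of "\<lambda>_. 1" "\<lambda>_. 0" "\<lambda>_. 0"]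
  show "expectation W = 0" "integrable M (\<lambda>\<omega>. (W \<omega>)\<^sup>2)"
    using * centered_gaussian_process_expectation[OF gp B] by (auto intro: quad_bounded_const)
qed

(* P s and Q s are the integrals of exp (-alpha p) * G (s + p) and exp (-beta q) * G (s - q)
   over p > 0 and q > 0; they are characterized by differential equations. *)
lemma fOU_cross_moment:
  fixes B B' :: "real \<Rightarrow> 'a \<Rightarrow> real" and W :: "'a \<Rightarrow> real" and W' :: "real \<Rightarrow> 'a \<Rightarrow> real"
  assumes gp: "centered_gaussian_process M I X"
    and B: "\<And>u. linear_combination I X (B u)" "\<And>u. linear_combination I X (B' u)"
    and pos: "\<alpha> > 0" "\<beta> > 0"
    and W: "W \<in> borel_measurable M" "\<And>b. W' b \<in> borel_measurable M"
    and RS: "AE \<omega> in M. has_RS_integral_from_minus_infinity (\<lambda>s. exp (- \<alpha> * (t - s))) (\<lambda>s. B s \<omega>) t (W \<omega>)"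
    and RS': "\<And>b. AE \<omega> in M. has_RS_integral_from_minus_infinity (\<lambda>s. exp (- \<beta> * (b - s))) (\<lambda>s. B' s \<omega>) b (W' b \<omega>)"
    and cov: "\<And>u v. expectation (\<lambda>\<omega>. B u \<omega> * B' v \<omega>) = A u + D v - G (v - u)"
    and A: "continuous_on UNIV A" "quad_bounded A"
    and G: "continuous_on UNIV G" "quad_bounded G"
  shows "\<exists>P Q. (\<forall>x. (P has_real_derivative \<alpha> * P x - G x) (at x)) \<and> quad_bounded P \<and>
      (\<forall>x. (Q has_real_derivative G x - \<beta> * Q x) (at x)) \<and>
      (\<forall>s. expectation (\<lambda>\<omega>. W \<omega> * W' (t + s) \<omega>) = \<alpha>\<^sup>2 / (\<alpha> + \<beta>) * P s + \<beta>\<^sup>2 / (\<alpha> + \<beta>) * Q s - G s)"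
proof -
  have contG: "continuous_on UNIV (\<lambda>x. G (f x))" if "continuous_on UNIV f" for f :: "real \<Rightarrow> real"
    using continuous_on_compose2[OF G(1) that] by simp
  obtain VA where VA: "\<And>x. (VA has_real_derivative A x - \<alpha> * VA x) (at x)" "quad_bounded VA"
    using exp_convolution_exists[OF A pos(1)] by blast
  obtain Q where Q: "\<And>x. (Q has_real_derivative G x - \<beta> * Q x) (at x)" "quad_bounded Q"
    using exp_convolution_exists[OF G pos(2)] by blast
  have "continuous_on UNIV (\<lambda>x. G (0 - x))" "quad_bounded (\<lambda>x. G (0 - x))"
    by (intro contG continuous_intros) (rule quad_bounded_reflect[OF G(2)])
  then obtain P' where P': "\<And>x. (P' has_real_derivative G (0 - x) - \<alpha> * P' x) (at x)" "quad_bounded P'"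
    using exp_convolution_exists[OF _ _ pos(1)] by blast
  \<comment> \<open>The first integration runs over past times u = t - p and sees G (v - u) = G (v -
    t + p), which looks forward. A forward average is the backward average of the reflected kernel,
    reflected again.\<close>
  define P where "P x = P' (0 - x)" for x
  have P: "(P has_real_derivative \<alpha> * P x - G x) (at x)" for x
  proof -
    have "((\<lambda>x. P' (0 - x)) has_real_derivative (G (0 - (0 - x)) - \<alpha> * P' (0 - x)) * (- 1)) (at x)"
      by (rule DERIV_chain2[OF P'(1)]) (auto intro!: derivative_eq_intros)
    then show ?thesis unfolding P_def by (simp add: algebra_simps)
  qed
  have Pq: "quad_bounded P" unfolding P_def by (rule quad_bounded_reflect[OF P'(2)])
  have contP: "continuous_on UNIV P"
    by (rule continuous_at_imp_continuous_on) (use P DERIV_isCont in blast)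
  note gl = centered_gaussian_process_linear_combination[OF gp]
  have BM: "B' v \<in> borel_measurable M" "integrable M (\<lambda>\<omega>. (B' v \<omega>)\<^sup>2)" for v
    using gl[OF B(2)] by (auto simp: gaussian_like_def)
  have W2: "integrable M (\<lambda>\<omega>. (W \<omega>)\<^sup>2)"
    by (rule fOU_expectation[OF gp B(1) pos(1) W(1) RS])
  define c0 where "c0 = A t - \<alpha> * VA t"
  \<comment> \<open>First integration, with v held fixed: \<open>D v\<close> is then a constant and
    contributes D v - \<alpha> (D v / \<alpha>) = 0. What is left of \<open>A\<close> is the number
    \<open>c0\<close>, which the second integration removes in the same way.\<close>
  have step1: "expectation (\<lambda>\<omega>. W \<omega> * B' v \<omega>) = c0 + \<alpha> * P (v - t) - G (v - t)" for v
  proof -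
    have "expectation (\<lambda>\<omega>. B' v \<omega> * W \<omega>)
        = (A t + D v - G (v - t)) - \<alpha> * (VA t + D v / \<alpha> - P (v - t))"
    proof (rule fOU_expectation_mult(1)[OF gp B(1) pos(1) W(1) RS BM])
      show "expectation (\<lambda>\<omega>. B' v \<omega> * B u \<omega>) = A u + D v - G (v - u)" for u
        using cov[of u v] by (simp add: mult.commute)
      show "continuous_on UNIV (\<lambda>u. A u + D v - G (v - u))"
        by (intro continuous_intros A contG)
      show "quad_bounded (\<lambda>u. A u + D v - G (v - u))"
        by (intro quad_bounded_diff quad_bounded_add quad_bounded_const A
            quad_bounded_reflect[OF G(2)])
      show "quad_bounded (\<lambda>u. VA u + D v / \<alpha> - P (v - u))"
        by (intro quad_bounded_diff quad_bounded_add quad_bounded_const VA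
            quad_bounded_reflect[OF Pq])
      show "((\<lambda>u. VA u + D v / \<alpha> - P (v - u)) has_real_derivative
          A x + D v - G (v - x) - \<alpha> * (VA x + D v / \<alpha> - P (v - x))) (at x)" for x
        using pos(1)
        by (auto intro!: derivative_eq_intros VA DERIV_chain2[OF P] simp: field_simps)
    qed
    moreover have "\<alpha> * (VA t + D v / \<alpha> - P (v - t)) = \<alpha> * VA t + D v - \<alpha> * P (v - t)"
      using pos(1) by (simp add: right_diff_distrib distrib_left)
    moreover have "expectation (\<lambda>\<omega>. W \<omega> * B' v \<omega>) = expectation (\<lambda>\<omega>. B' v \<omega> * W \<omega>)"
      by (simp add: mult.commute)
    ultimately show ?thesis unfolding c0_def by linarith
  qed
  \<comment> \<open>The second integration needs a solution of V' = (c0 + \<alpha> P - G) - \<beta>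
    V. The ansatz V = y + \<gamma> P + (\<gamma> - 1) Q matches G and Q for every \<gamma>; the
    constants require \<beta> y = c0, and the coefficient of P requires \<gamma> \<alpha> = \<alpha>
    - \<beta> \<gamma>.\<close>
  define \<gamma> \<delta> y where "\<gamma> = \<alpha> / (\<alpha> + \<beta>)" and "\<delta> = \<beta> / (\<alpha> + \<beta>)" and "y = c0 / \<beta>"
  have ab: "\<alpha> + \<beta> \<noteq> 0" using pos by linarith
  then have \<gamma>: "\<gamma> * (\<alpha> + \<beta>) = \<alpha>" and \<gamma>\<delta>: "\<gamma> + \<delta> = 1" and y: "\<beta> * y = c0"
    using pos by (simp_all add: \<gamma>_def \<delta>_def y_def add_divide_distrib[symmetric])
  define V where "V v = y + (\<gamma> * (P (v - t) + Q (v - t)) - Q (v - t))" for v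
  have shift: "quad_bounded (\<lambda>v. f (v - t))" if "quad_bounded f" for f
    using quad_bounded_reflect[OF quad_bounded_reflect[OF that, of 0], of t] by simp
  have "expectation (\<lambda>\<omega>. W \<omega> * W' (t + s) \<omega>)
      = (c0 + \<alpha> * P (t + s - t) - G (t + s - t)) - \<beta> * V (t + s)" for s
  proof (rule fOU_expectation_mult(1)[OF gp B(2) pos(2) W(2) RS' W(1) W2 step1])
    show "continuous_on UNIV (\<lambda>v. c0 + \<alpha> * P (v - t) - G (v - t))"
      by (intro continuous_intros contG continuous_on_compose2[OF contP]) auto
    show "quad_bounded (\<lambda>v. c0 + \<alpha> * P (v - t) - G (v - t))"
      by (intro quad_bounded_diff quad_bounded_add quad_bounded_mult_const quad_bounded_const
          shift[OF Pq] shift[OF G(2)])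
    show "quad_bounded V" unfolding V_def
      by (intro quad_bounded_diff quad_bounded_add quad_bounded_mult_const quad_bounded_const
          shift[OF Pq] shift[OF Q(2)])
    fix x
    have "((\<lambda>v. P (v - t)) has_real_derivative (\<alpha> * P (x - t) - G (x - t)) * 1) (at x)"
      by (rule DERIV_chain2[OF P]) (auto intro!: derivative_eq_intros)
    moreover have "((\<lambda>v. Q (v - t)) has_real_derivative (G (x - t) - \<beta> * Q (x - t)) * 1) (at x)"
      by (rule DERIV_chain2[OF Q(1)]) (auto intro!: derivative_eq_intros)
    ultimately have "(V has_real_derivative
        0 + (\<gamma> * ((\<alpha> * P (x - t) - G (x - t)) * 1 + (G (x - t) - \<beta> * Q (x - t)) * 1)
        - (G (x - t) - \<beta> * Q (x - t)) * 1)) (at x)"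
      unfolding V_def by (intro DERIV_add DERIV_diff DERIV_cmult DERIV_const)
    moreover have "0 + (\<gamma> * ((\<alpha> * p - g) * 1 + (g - \<beta> * q) * 1) - (g - \<beta> * q) * 1)
        = c0 + \<alpha> * p - g - \<beta> * (y + (\<gamma> * (p + q) - q))" for p q g
    proof -
      have "p * (\<gamma> * (\<alpha> + \<beta>)) = p * \<alpha>" by (simp only: \<gamma>)
      then show ?thesis using y by (simp add: algebra_simps)
    qed
    ultimately show "(V has_real_derivative c0 + \<alpha> * P (x - t) - G (x - t) - \<beta> * V x) (at x)"
      by (simp only: V_def)
  qed
  moreover have "(c0 + \<alpha> * p - g) - \<beta> * (y + (\<gamma> * (p + q) - q))
      = \<alpha> * \<gamma> * p + \<beta> * \<delta> * q - g" for p q g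
  proof -
    have "p * (\<gamma> * (\<alpha> + \<beta>)) = p * \<alpha>" "\<beta> * q * (\<gamma> + \<delta>) = \<beta> * q" by (simp_all only: \<gamma> \<gamma>\<delta> mult_1_right)
    then show ?thesis using y by (simp add: algebra_simps)
  qed
  moreover have "\<alpha> * \<gamma> = \<alpha>\<^sup>2 / (\<alpha> + \<beta>)" "\<beta> * \<delta> = \<beta>\<^sup>2 / (\<alpha> + \<beta>)"
    by (simp_all add: \<gamma>_def \<delta>_def power2_eq_square)
  ultimately have "expectation (\<lambda>\<omega>. W \<omega> * W' (t + s) \<omega>)
      = \<alpha>\<^sup>2 / (\<alpha> + \<beta>) * P s + \<beta>\<^sup>2 / (\<alpha> + \<beta>) * Q s - G s" for s
    by (simp only: V_def add_diff_cancel_left')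
  with P Pq Q show ?thesis by blast
qed

end

section \<open>The covariance kernels\<close>

definition pow_kernel :: "real \<Rightarrow> real \<Rightarrow> real \<Rightarrow> real \<Rightarrow> real" where
  "pow_kernel c d h x = (c + d * sign1 x) * \<bar>x\<bar> powr h"

definition log_kernel :: "real \<Rightarrow> real \<Rightarrow> real \<Rightarrow> real" where
  "log_kernel c d x = c * \<bar>x\<bar> + d * (x * ln \<bar>x\<bar>)"

lemma continuous_on_pow_kernel:
  assumes "h > 0"
  shows "continuous_on UNIV (pow_kernel c d h)"
proof -
  \<comment> \<open>\<open>sign1\<close> jumps at 0, where the power vanishes. Splitting into the
    powers of the positive and negative parts removes the jump from the formula.\<close>
  have "pow_kernel c d h x = (c + d) * max x 0 powr h + (c - d) * max (- x) 0 powr h" for x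
    by (auto simp: pow_kernel_def sign1_def max_def)
  then have "pow_kernel c d h = (\<lambda>x. (c + d) * max x 0 powr h + (c - d) * max (- x) 0 powr h)" by blast
  moreover have "continuous_on UNIV (\<lambda>x. (c + d) * max x 0 powr h + (c - d) * max (- x) 0 powr h)"
    by (intro continuous_intros continuous_on_powr') (use assms in auto)
  ultimately show ?thesis by simp
qed

lemma quad_bounded_pow_kernel:
  assumes "0 \<le> h" "h \<le> 2"
  shows "quad_bounded (pow_kernel c d h)"
  unfolding quad_bounded_def
proof (intro exI allI)
  fix x :: real
  have "\<bar>x\<bar> powr h \<le> 1 + x\<^sup>2"
  proof (cases "\<bar>x\<bar> \<le> 1")
    case True
    then have "\<bar>x\<bar> powr h \<le> 1" using powr_mono2[of h "\<bar>x\<bar>" 1] assms by simp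
    then show ?thesis by (smt (verit) zero_le_power2)
  next
    case False
    then have "\<bar>x\<bar> powr h \<le> \<bar>x\<bar> powr 2" by (intro powr_mono) (use assms in auto)
    then show ?thesis using False by (simp add: powr_numeral)
  qed
  moreover have "\<bar>c + d * sign1 x\<bar> \<le> \<bar>c\<bar> + \<bar>d\<bar>" by (auto simp: sign1_def)
  ultimately show "\<bar>pow_kernel c d h x\<bar> \<le> (\<bar>c\<bar> + \<bar>d\<bar>) * (1 + x\<^sup>2)"
    unfolding pow_kernel_def abs_mult by (intro mult_mono) auto
qed

lemma continuous_on_log_kernel: "continuous_on UNIV (log_kernel c d)"
proof -
  have "isCont (\<lambda>x::real. x * ln \<bar>x\<bar>) x" for x
  proof (cases "x = 0")
    case True
    have "((\<lambda>x::real. x * ln \<bar>x\<bar>) \<longlongrightarrow> 0) (at_left 0)" "((\<lambda>x::real. x * ln \<bar>x\<bar>) \<longlongrightarrow> 0) (at_right 0)"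
      by real_asymp+
    then have "((\<lambda>x::real. x * ln \<bar>x\<bar>) \<longlongrightarrow> 0) (at 0)" by (simp add: filterlim_split_at)
    then show ?thesis using True by (simp add: isCont_def)
  qed (auto intro!: continuous_intros)
  then have "continuous_on UNIV (\<lambda>x::real. x * ln \<bar>x\<bar>)"
    by (simp add: continuous_at_imp_continuous_on)
  then have "continuous_on UNIV (\<lambda>x. c * \<bar>x\<bar> + d * (x * ln \<bar>x\<bar>))"
    by (intro continuous_on_add continuous_on_mult_left continuous_on_rabs continuous_on_id)
  then show ?thesis by (simp add: log_kernel_def[abs_def])
qed

lemma quad_bounded_log_kernel: "quad_bounded (log_kernel c d)"
  unfolding quad_bounded_def
proof (intro exI allI)
  fix x :: real
  have abs: "\<bar>x\<bar> \<le> 1 + x\<^sup>2"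
    using sum_squares_bound[of "\<bar>x\<bar>" 1] by simp
  have log: "\<bar>x * ln \<bar>x\<bar>\<bar> \<le> 1 + x\<^sup>2"
  proof -
    consider "x = 0" | "0 < \<bar>x\<bar>" "\<bar>x\<bar> < 1" | "\<bar>x\<bar> \<ge> 1" by fastforce
    then show ?thesis
    proof cases
      case 2
      have "- ln \<bar>x\<bar> \<le> 1 / \<bar>x\<bar> - 1" using ln_le_minus_one[of "1 / \<bar>x\<bar>"] 2 by (simp add: ln_div)
      then have "\<bar>x\<bar> * (- ln \<bar>x\<bar>) \<le> \<bar>x\<bar> * (1 / \<bar>x\<bar> - 1)" by (intro mult_left_mono) auto
      also have "\<dots> = 1 - \<bar>x\<bar>" using 2 by (simp add: right_diff_distrib)
      also have "\<dots> \<le> 1 + x\<^sup>2" by (smt (verit) zero_le_power2)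
      finally show ?thesis using 2 by (simp add: abs_mult)
    next
      case 3
      have "\<bar>x\<bar> * ln \<bar>x\<bar> \<le> \<bar>x\<bar> * \<bar>x\<bar>"
        using ln_le_minus_one[of "\<bar>x\<bar>"] 3 by (intro mult_left_mono) linarith+
      then show ?thesis using 3 by (simp add: abs_mult power2_eq_square)
    qed simp
  qed
  have "\<bar>log_kernel c d x\<bar> \<le> \<bar>c\<bar> * \<bar>x\<bar> + \<bar>d\<bar> * \<bar>x * ln \<bar>x\<bar>\<bar>"
    unfolding log_kernel_def by (rule order_trans[OF abs_triangle_ineq]) (simp add: abs_mult)
  also have "\<dots> \<le> \<bar>c\<bar> * (1 + x\<^sup>2) + \<bar>d\<bar> * (1 + x\<^sup>2)"
    by (intro add_mono mult_left_mono abs log) auto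
  finally show "\<bar>log_kernel c d x\<bar> \<le> (\<bar>c\<bar> + \<bar>d\<bar>) * (1 + x\<^sup>2)" by (simp add: distrib_right)
qed

section \<open>Closed forms of the iterated derivatives of the kernels on the positive
  half-line\<close>

definition pow_deriv :: "real \<Rightarrow> real \<Rightarrow> nat \<Rightarrow> real \<Rightarrow> real" where
  "pow_deriv c h n x = c * (\<Prod>k<n. h - real k) * x powr (h - real n)"

text \<open>From order 2 on the linear part and the logarithm have disappeared: only pure powers
  remain, and with them only the coefficient \<open>d\<close>. This is why \<rho> is absent from the
  expansion for h = 1.\<close>

fun log_deriv :: "real \<Rightarrow> real \<Rightarrow> nat \<Rightarrow> real \<Rightarrow> real" where
  "log_deriv c d 0 x = c * x + d * (x * ln x)"
| "log_deriv c d (Suc 0) x = c + d * (ln x + 1)"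
| "log_deriv c d (Suc (Suc n)) x = d * (\<Prod>k<n. - real k - 1) * x powr (- 1 - real n)"

lemma DERIV_pow_deriv:
  assumes "x > 0"
  shows "(pow_deriv c h n has_real_derivative pow_deriv c h (Suc n) x) (at x)"
proof -
  have "(pow_deriv c h n has_real_derivative
      c * (\<Prod>k<n. h - real k) * ((h - real n) * x powr (h - real n - 1))) (at x)"
    unfolding pow_deriv_def[abs_def] by (intro DERIV_cmult has_real_derivative_powr assms)
  then show ?thesis by (simp add: pow_deriv_def algebra_simps)
qed

lemma DERIV_log_deriv:
  assumes "x > 0"
  shows "(log_deriv c d n has_real_derivative log_deriv c d (Suc n) x) (at x)"
proof -
  consider (0) "n = 0" | (1) "n = Suc 0" | (Suc) m where "n = Suc (Suc m)"
    by (metis not0_implies_Suc)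
  then show ?thesis
  proof cases
  case 0
  have "((\<lambda>x. c * x + d * (x * ln x)) has_real_derivative c + d * (ln x + 1)) (at x)"
    using assms by (auto intro!: derivative_eq_intros)
  moreover have "log_deriv c d n = (\<lambda>x. c * x + d * (x * ln x))" using 0 by (simp add: fun_eq_iff)
  ultimately show ?thesis using 0 by simp
next
  case 1
  have "((\<lambda>x. c + d * (ln x + 1)) has_real_derivative d * (1 / x)) (at x)"
    using assms by (auto intro!: derivative_eq_intros)
  moreover have "log_deriv c d n = (\<lambda>x. c + d * (ln x + 1))" using 1 by (simp add: fun_eq_iff)
  ultimately show ?thesis using 1 assms by (simp add: powr_minus_divide)
next
  case (Suc m)
  have "((\<lambda>x. d * (\<Prod>k<m. - real k - 1) * x powr (- 1 - real m)) has_real_derivative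
      d * (\<Prod>k<m. - real k - 1) * ((- 1 - real m) * x powr (- 1 - real m - 1))) (at x)"
    by (intro DERIV_cmult has_real_derivative_powr assms)
  moreover have "log_deriv c d n = (\<lambda>x. d * (\<Prod>k<m. - real k - 1) * x powr (- 1 - real m))"
    using Suc by (simp add: fun_eq_iff)
  moreover have "d * (\<Prod>k<m. - real k - 1) * ((- 1 - real m) * x powr (- 1 - real m - 1)) = log_deriv c d (Suc n) x"
  proof -
    have "- 1 - real m - 1 = - 1 - real (Suc m)" "(- 1 - real m) * z = (- real m - 1) * z" for z by simp_all
    then show ?thesis by (simp only: Suc log_deriv.simps prod.lessThan_Suc mult.assoc)
  qed
  ultimately show ?thesis by simp
qed
qed

lemma exp_pow_deriv_tendsto_0:
  assumes "\<alpha> > 0"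
  shows "((\<lambda>x. exp (- \<alpha> * x) * pow_deriv c h n x) \<longlongrightarrow> 0) at_top"
proof -
  have "((\<lambda>x. exp (- \<alpha> * x) * x powr (h - real n)) \<longlongrightarrow> 0) at_top" using assms by real_asymp
  then have "((\<lambda>x. c * (\<Prod>k<n. h - real k) * (exp (- \<alpha> * x) * x powr (h - real n))) \<longlongrightarrow> 0) at_top"
    by (rule tendsto_mult_right_zero)
  then show ?thesis by (simp add: pow_deriv_def mult_ac)
qed

lemma exp_log_deriv_tendsto_0:
  assumes "\<alpha> > 0"
  shows "((\<lambda>x. exp (- \<alpha> * x) * log_deriv c d n x) \<longlongrightarrow> 0) at_top"
proof -
  consider (0) "n = 0" | (1) "n = Suc 0" | (Suc) m where "n = Suc (Suc m)"
    by (metis not0_implies_Suc)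
  then show ?thesis
  proof cases
  case 0
  have "((\<lambda>x. exp (- \<alpha> * x) * x) \<longlongrightarrow> 0) at_top" "((\<lambda>x. exp (- \<alpha> * x) * (x * ln x)) \<longlongrightarrow> 0) at_top"
    using assms by real_asymp+
  then have "((\<lambda>x. c * (exp (- \<alpha> * x) * x) + d * (exp (- \<alpha> * x) * (x * ln x))) \<longlongrightarrow> 0) at_top"
    by (intro tendsto_add_zero tendsto_mult_right_zero)
  with 0 show ?thesis by (simp add: algebra_simps)
next
  case 1
  have "((\<lambda>x. exp (- \<alpha> * x)) \<longlongrightarrow> 0) at_top" "((\<lambda>x. exp (- \<alpha> * x) * (ln x + 1)) \<longlongrightarrow> 0) at_top"
    using assms by real_asymp+
  then have "((\<lambda>x. c * exp (- \<alpha> * x) + d * (exp (- \<alpha> * x) * (ln x + 1))) \<longlongrightarrow> 0) at_top"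
    by (intro tendsto_add_zero tendsto_mult_right_zero)
  with 1 show ?thesis by (simp add: algebra_simps)
next
  case (Suc m)
  have "((\<lambda>x. exp (- \<alpha> * x) * x powr (- 1 - real m)) \<longlongrightarrow> 0) at_top" using assms by real_asymp
  then have "((\<lambda>x. d * (\<Prod>k<m. - real k - 1) * (exp (- \<alpha> * x) * x powr (- 1 - real m))) \<longlongrightarrow> 0) at_top"
    by (rule tendsto_mult_right_zero)
  with Suc show ?thesis by (simp add: mult_ac)
qed
qed

text \<open>For v > u the last kernel is (\<rho> - e) / 2 times a power. With e =
  \<open>\<eta> i j\<close> = - \<open>\<eta> j i\<close> this produces the factor \<rho> +
  \<open>\<eta> j i\<close> of the expansion.\<close>

lemma fbm_cross_cov_pow_kernel:
  assumes "h \<noteq> 1"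
  shows "fbm_cross_cov h \<rho> e u v
     = pow_kernel (\<rho> / 2) (e / 2) h u + pow_kernel (\<rho> / 2) (- e / 2) h v - pow_kernel (\<rho> / 2) (- e / 2) h (v - u)"
  using assms by (simp add: fbm_cross_cov_def pow_kernel_def field_simps)

text \<open>In contrast to the power case, \<open>e\<close> enters the kernel of v - u with a plus
  sign, so the expansion for h = 1 carries \<open>\<eta> i j\<close>.\<close>

lemma fbm_cross_cov_log_kernel:
  "fbm_cross_cov 1 \<rho> e u v
     = log_kernel (\<rho> / 2) (- e / 2) u + log_kernel (\<rho> / 2) (e / 2) v - log_kernel (\<rho> / 2) (e / 2) (v - u)"
  by (simp add: fbm_cross_cov_def log_kernel_def field_simps)

text \<open>The remainders of the forward and backward averages cancel to leading order when N is
  even and the two rates agree; the hypothesis excludes just this.\<close>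

lemma remainder_coefficient_nonzero:
  fixes \<alpha> \<beta> :: real
  assumes "\<alpha> > 0" "\<beta> > 0" "\<alpha> \<noteq> \<beta> \<or> odd N"
  shows "1 / \<alpha> ^ (N + 2) - (- 1) ^ N / \<beta> ^ (N + 2) \<noteq> 0"
proof (cases "odd N")
  case True
  then have "1 / \<alpha> ^ (N + 2) - (- 1) ^ N / \<beta> ^ (N + 2) = 1 / \<alpha> ^ (N + 2) + 1 / \<beta> ^ (N + 2)" by simp
  also have "\<dots> > 0" using assms by (intro add_pos_pos) simp_all
  finally show ?thesis by simp
next
  case False
  then have ne: "\<alpha> \<noteq> \<beta>" using assms by blast
  show ?thesis
  proof
    assume "1 / \<alpha> ^ (N + 2) - (- 1) ^ N / \<beta> ^ (N + 2) = 0"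
    then have "1 / \<alpha> ^ (N + 2) = 1 / \<beta> ^ (N + 2)" using False by simp
    then have "\<alpha> ^ (N + 2) = \<beta> ^ (N + 2)" by (metis div_by_1 divide_divide_eq_right mult_1)
    then have "\<alpha> = \<beta>" by (rule power_eq_imp_eq_base) (use assms in auto)
    with ne show False ..
  qed
qed

text \<open>Common source of the cases h = 1 and h \<noteq> 1: the kernel enters through its
  splitting and growth, and through its derivatives \<open>g n\<close> on the positive half-line,
  where a lag s > 0 evaluates it.\<close>

lemma fOU_covariance_expansion:
  assumes "prob_space M"
    and \<alpha>\<nu>: "\<forall>k\<in>{1,2}. \<alpha> k > 0 \<and> \<nu> k > 0"
    and fbm: "bivariate_fbm M H \<rho> \<eta> B"
    and fou: "bivariate_fOU M \<alpha> \<nu> B Y"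
    and ij: "i \<in> {1,2}" "j \<in> {1,2}" "i \<noteq> j"
    and cov: "\<And>u v. fbm_cross_cov (H 1 + H 2) \<rho> (\<eta> i j) u v = A u + D v - G (v - u)"
    and A: "continuous_on UNIV A" "quad_bounded A"
    and G: "continuous_on UNIV G" "quad_bounded G"
    and g0: "\<And>x. x > 0 \<Longrightarrow> G x = g 0 x"
    and g: "\<And>n x. x > 0 \<Longrightarrow> (g n has_real_derivative g (Suc n) x) (at x)"
    and gexp: "\<And>n. ((\<lambda>x. exp (- \<alpha> i * x) * g n x) \<longlongrightarrow> 0) at_top"
    and top: "\<And>x. x > 0 \<Longrightarrow> g (N + 3) x = \<kappa> * x powr a"
  shows "((\<lambda>s. (covariance M (Y i t) (Y j (t + s))
              - \<nu> 1 * \<nu> 2 * (\<Sum>n=0..N. ((- 1) ^ n / \<alpha> j ^ (n + 1) + 1 / \<alpha> i ^ (n + 1)) / (\<alpha> 1 + \<alpha> 2) * g (n + 2) s))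
             / s powr a)
      \<longlongrightarrow> \<nu> 1 * \<nu> 2 * (\<kappa> * (1 / \<alpha> i ^ (N + 2) - (- 1) ^ N / \<alpha> j ^ (N + 2)) / (\<alpha> 1 + \<alpha> 2))) at_top"
proof -
  interpret prob_space M by fact
  have sym: "\<nu> 1 * \<nu> 2 = \<nu> i * \<nu> j" "\<alpha> 1 + \<alpha> 2 = \<alpha> i + \<alpha> j" using ij by auto
  have pos: "\<alpha> i > 0" "\<alpha> j > 0" "\<nu> i > 0" "\<nu> j > 0" using \<alpha>\<nu> ij by auto
  define X where "X = (\<lambda>(i, t). B i t)"
  have gp: "centered_gaussian_process M ({1,2} \<times> UNIV) X"
    using fbm by (simp add: bivariate_fbm_def X_def)
  have lc: "linear_combination ({1,2} \<times> UNIV) X (B k u)" if "k \<in> {1,2}" for k u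
    using linear_combination_base[of "(k, u)" "{1,2} \<times> UNIV" X] that by (simp add: X_def)
  \<comment> \<open>The value of the pathwise integral is only existentially quantified in
    \<open>bivariate_fOU\<close>; dividing by \<nu> k > 0 recovers it as a measurable
    variable.\<close>
  define W where "W k b \<omega> = Y k b \<omega> / \<nu> k" for k b \<omega>
  have Wm: "W k b \<in> borel_measurable M" if "k \<in> {1,2}" for k b
    using fou that unfolding W_def[abs_def] bivariate_fOU_def
    by (intro borel_measurable_divide) auto
  have RS: "AE \<omega> in M. has_RS_integral_from_minus_infinity (\<lambda>s. exp (- \<alpha> k * (b - s))) (\<lambda>s. B k s \<omega>) b (W k b \<omega>)"
    if k: "k \<in> {1,2}" for k b
  proof -
    have "AE \<omega> in M. \<forall>i\<in>{1,2}. \<forall>t. \<exists>I.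
        has_RS_integral_from_minus_infinity (\<lambda>s. exp (- \<alpha> i * (t - s))) (\<lambda>s. B i s \<omega>) t I \<and> Y i t \<omega> = \<nu> i * I"
      using fou by (simp add: bivariate_fOU_def)
    then show ?thesis
    proof eventually_elim
      case (elim \<omega>)
      then obtain I where I: "has_RS_integral_from_minus_infinity (\<lambda>s. exp (- \<alpha> k * (b - s))) (\<lambda>s. B k s \<omega>) b I"
        "Y k b \<omega> = \<nu> k * I" using k by blast
      then have "W k b \<omega> = I" using k \<alpha>\<nu> by (auto simp: W_def)
      with I show ?case by simp
    qed
  qed
  have Y: "Y k b = (\<lambda>\<omega>. \<nu> k * W k b \<omega>)" if "k \<in> {1,2}" for k b
    using that \<alpha>\<nu> by (auto simp: W_def)
  have mean: "expectation (W k b) = 0" if "k \<in> {1,2}" for k b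
    using fOU_expectation(1)[OF gp lc[OF that] _ Wm[OF that] RS[OF that]] \<alpha>\<nu> that by blast
  have covB: "expectation (\<lambda>\<omega>. B i u \<omega> * B j v \<omega>) = A u + D v - G (v - u)" for u v
    using fbm ij cov[of u v] by (auto simp: bivariate_fbm_def)
  obtain P Q where P: "\<And>x. (P has_real_derivative \<alpha> i * P x - G x) (at x)" "quad_bounded P"
    and Q: "\<And>x. (Q has_real_derivative G x - \<alpha> j * Q x) (at x)"
    and moment: "\<And>s. expectation (\<lambda>\<omega>. W i t \<omega> * W j (t + s) \<omega>)
        = (\<alpha> i)\<^sup>2 / (\<alpha> i + \<alpha> j) * P s + (\<alpha> j)\<^sup>2 / (\<alpha> i + \<alpha> j) * Q s - G s"
    using fOU_cross_moment[OF gp lc[OF ij(1)] lc[OF ij(2)] pos(1,2) Wm[OF ij(1)] Wm[OF ij(2)]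
        RS[OF ij(1)] RS[OF ij(2)] covB A G] by blast
  have covY: "covariance M (Y i t) (Y j (t + s)) = \<nu> i * \<nu> j *
      ((\<alpha> i)\<^sup>2 / (\<alpha> i + \<alpha> j) * P s + (\<alpha> j)\<^sup>2 / (\<alpha> i + \<alpha> j) * Q s - G s)" for s
  proof -
    have "covariance M (Y i t) (Y j (t + s)) = expectation (\<lambda>\<omega>. \<nu> i * \<nu> j * (W i t \<omega> * W j (t + s) \<omega>))"
      unfolding covariance_def Y[OF ij(1)] Y[OF ij(2)] by (simp add: mean[OF ij(1)] mean[OF ij(2)] mult_ac)
    then show ?thesis by (simp add: moment)
  qed
  have "((\<lambda>s. \<nu> i * \<nu> j * (((\<alpha> i)\<^sup>2 / (\<alpha> i + \<alpha> j) * P s + (\<alpha> j)\<^sup>2 / (\<alpha> i + \<alpha> j) * Q s - g 0 s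
             - (\<Sum>n=0..N. ((- 1) ^ n / \<alpha> j ^ (n + 1) + 1 / \<alpha> i ^ (n + 1)) / (\<alpha> i + \<alpha> j) * g (n + 2) s))
            / s powr a))
     \<longlongrightarrow> \<nu> i * \<nu> j * (\<kappa> * (1 / \<alpha> i ^ (N + 2) - (- 1) ^ N / \<alpha> j ^ (N + 2)) / (\<alpha> i + \<alpha> j))) at_top"
  proof (intro tendsto_mult_left ou_kernel_expansion[OF pos(1,2) _ _ _ g gexp top])
    show "((\<lambda>x. exp (- \<alpha> i * x) * P x) \<longlongrightarrow> 0) at_top"
      using quad_bounded_exp_tendsto_0[OF P(2) pos(1), of 0 1] by simp
  qed (use P(1) Q g0 in metis)+
  \<comment> \<open>The two expressions agree for s > 0 only, since \<open>g 0\<close> represents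
    \<open>G\<close> there.\<close>
  moreover have "\<forall>\<^sub>F s in at_top. \<nu> i * \<nu> j * (((\<alpha> i)\<^sup>2 / (\<alpha> i + \<alpha> j) * P s + (\<alpha> j)\<^sup>2 / (\<alpha> i + \<alpha> j) * Q s - g 0 s
             - (\<Sum>n=0..N. ((- 1) ^ n / \<alpha> j ^ (n + 1) + 1 / \<alpha> i ^ (n + 1)) / (\<alpha> i + \<alpha> j) * g (n + 2) s))
            / s powr a) = (covariance M (Y i t) (Y j (t + s))
              - \<nu> i * \<nu> j * (\<Sum>n=0..N. ((- 1) ^ n / \<alpha> j ^ (n + 1) + 1 / \<alpha> i ^ (n + 1)) / (\<alpha> i + \<alpha> j) * g (n + 2) s))
             / s powr a"
    using eventually_gt_at_top[of 0]
  proof eventually_elim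
    case (elim s)
    show ?case unfolding covY g0[OF elim] by (simp only: right_diff_distrib times_divide_eq_right)
  qed
  ultimately show ?thesis unfolding sym by (rule Lim_transform_eventually)
qed

text \<open>The witness for C is \<nu> 1 \<nu> 2 \<kappa> (1 / \<alpha> i ^ (N + 2) - (- 1) ^ N /
  \<alpha> j ^ (N + 2)) / (\<alpha> 1 + \<alpha> 2), with \<kappa> the coefficient of the derivative
  of order N + 3 of the kernel. Its sign depends on the parameters, and it vanishes when \<alpha> i
  = \<alpha> j with N even, or when \<kappa> = 0; hence the conditions under which C \<noteq> 0 is
  asserted.\<close>

theorem theorem5p4p8:
  fixes M :: "'a measure"
    and B Y :: "nat \<Rightarrow> real \<Rightarrow> 'a \<Rightarrow> real"
    and H \<alpha> \<nu> :: "nat \<Rightarrow> real"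
    and \<eta> :: "nat \<Rightarrow> nat \<Rightarrow> real"
    and h \<rho> t :: real
    and N i j :: nat
  assumes "prob_space M"
    and "\<forall>k\<in>{1,2}. H k \<in> {0<..<1/2} \<union> {1/2<..<1}"
    and "h = H 1 + H 2"
    and "\<forall>k\<in>{1,2}. \<alpha> k > 0 \<and> \<nu> k > 0"
    and "bivariate_fbm M H \<rho> \<eta> B"
    and "bivariate_fOU M \<alpha> \<nu> B Y"
    and "i \<in> {1,2}" and "j \<in> {1,2}" and "i \<noteq> j"
  shows "(h \<noteq> 1 \<longrightarrow> (\<exists>C.
            ((\<lambda>s. (covariance M (Y i t) (Y j (t + s))
                   - \<nu> 1 * \<nu> 2 * (\<rho> + \<eta> j i) / (2 * (\<alpha> 1 + \<alpha> 2)) *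
                     (\<Sum>n=0..N. ((- 1) ^ n / \<alpha> j ^ (n + 1) + 1 / \<alpha> i ^ (n + 1)) *
                        (\<Prod>k=0..n+1. (h - real k)) * s powr (h - 2 - real n)))
                  / s powr (h - real N - 3)) \<longlongrightarrow> C) at_top \<and>
            (\<rho> + \<eta> j i \<noteq> 0 \<and> (\<alpha> i \<noteq> \<alpha> j \<or> odd N) \<longrightarrow> C \<noteq> 0))) \<and>
         (h = 1 \<longrightarrow> (\<exists>C.
            ((\<lambda>s. (covariance M (Y i t) (Y j (t + s))
                   - \<nu> 1 * \<nu> 2 * \<eta> i j / (2 * \<alpha> 1 * \<alpha> 2) * (1 / s)
                   - \<nu> 1 * \<nu> 2 * \<eta> i j / (2 * (\<alpha> 1 + \<alpha> 2)) *
                     (\<Sum>n=1..N. ((- 1) ^ n / \<alpha> j ^ (n + 1) + 1 / \<alpha> i ^ (n + 1)) *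
                        (\<Prod>k=0..n-1. (- real k - 1)) * s powr (- 1 - real n)))
                  / s powr (- real N - 2)) \<longlongrightarrow> C) at_top \<and>
            (\<eta> i j \<noteq> 0 \<and> (\<alpha> i \<noteq> \<alpha> j \<or> odd N) \<longrightarrow> C \<noteq> 0)))"
proof -
  have pos: "\<alpha> i > 0" "\<alpha> j > 0" "\<alpha> 1 > 0" "\<alpha> 2 > 0" "\<nu> 1 > 0" "\<nu> 2 > 0" using assms(4,7,8) by auto
  have \<eta>: "\<eta> i j = - \<eta> j i" using assms(5,7-9) by (auto simp: bivariate_fbm_def)
  have "0 < H k \<and> H k < 1" if "k \<in> {1,2}" for k using assms(2) that by fastforce
  from this[of 1] this[of 2] have h: "0 < h" "h < 2" using assms(3) by auto
  note expansion = fOU_covariance_expansion[OF assms(1,4-9), folded assms(3), of _ _ _ _ N _ _ t]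
  have C: "\<nu> 1 * \<nu> 2 * (\<kappa> * (1 / \<alpha> i ^ (N + 2) - (- 1) ^ N / \<alpha> j ^ (N + 2)) / (\<alpha> 1 + \<alpha> 2)) \<noteq> 0"
    if "\<kappa> \<noteq> 0" "\<alpha> i \<noteq> \<alpha> j \<or> odd N" for \<kappa>
    using that(1) remainder_coefficient_nonzero[OF pos(1,2) that(2)] pos by simp
  have frac: "c / a * (r / 2 * p * q) = r / (2 * a) * (c * p * q)" for c a r p q :: real
    by (simp add: mult_ac)
  show ?thesis
  proof (intro conjI impI)
    assume h1: "h \<noteq> 1"
    define G where "G = pow_kernel (\<rho> / 2) (- \<eta> i j / 2) h"
    define g where "g = pow_deriv ((\<rho> + \<eta> j i) / 2) h"
    define \<kappa> where "\<kappa> = (\<rho> + \<eta> j i) / 2 * (\<Prod>k<N+3. h - real k)"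
    have "((\<lambda>s. (covariance M (Y i t) (Y j (t + s))
              - \<nu> 1 * \<nu> 2 * (\<Sum>n=0..N. ((- 1) ^ n / \<alpha> j ^ (n + 1) + 1 / \<alpha> i ^ (n + 1)) / (\<alpha> 1 + \<alpha> 2) * g (n + 2) s))
             / s powr (h - real N - 3))
      \<longlongrightarrow> \<nu> 1 * \<nu> 2 * (\<kappa> * (1 / \<alpha> i ^ (N + 2) - (- 1) ^ N / \<alpha> j ^ (N + 2)) / (\<alpha> 1 + \<alpha> 2))) at_top"
    proof (rule expansion[OF fbm_cross_cov_pow_kernel[OF h1], folded G_def])
      show "G x = g 0 x" if "x > 0" for x
        using that by (simp add: G_def g_def pow_kernel_def pow_deriv_def sign1_def \<eta> add_divide_distrib)
      show "g (N + 3) x = \<kappa> * x powr (h - real N - 3)" for x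
        by (simp add: g_def pow_deriv_def \<kappa>_def diff_diff_eq)
    qed (use h pos in \<open>auto simp: G_def g_def intro!: continuous_on_pow_kernel quad_bounded_pow_kernel
          DERIV_pow_deriv exp_pow_deriv_tendsto_0[of "\<alpha> i", simplified]\<close>)
    moreover have "\<nu> 1 * \<nu> 2 * (\<Sum>n=0..N. ((- 1) ^ n / \<alpha> j ^ (n + 1) + 1 / \<alpha> i ^ (n + 1)) / (\<alpha> 1 + \<alpha> 2) * g (n + 2) s)
        = \<nu> 1 * \<nu> 2 * (\<rho> + \<eta> j i) / (2 * (\<alpha> 1 + \<alpha> 2)) *
                     (\<Sum>n=0..N. ((- 1) ^ n / \<alpha> j ^ (n + 1) + 1 / \<alpha> i ^ (n + 1)) *
                        (\<Prod>k=0..n+1. (h - real k)) * s powr (h - 2 - real n))" for s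
    proof -
      have "{0..n+1} = {..<n+2}" for n :: nat by auto
      moreover have "h - 2 - real n = h - real (n + 2)" for n by simp
      ultimately have "((- 1) ^ n / \<alpha> j ^ (n + 1) + 1 / \<alpha> i ^ (n + 1)) / (\<alpha> 1 + \<alpha> 2) * g (n + 2) s
          = (\<rho> + \<eta> j i) / (2 * (\<alpha> 1 + \<alpha> 2)) * (((- 1) ^ n / \<alpha> j ^ (n + 1) + 1 / \<alpha> i ^ (n + 1)) *
                        (\<Prod>k=0..n+1. (h - real k)) * s powr (h - 2 - real n))" for n
        by (simp only: g_def pow_deriv_def frac)
      note summand = this
      show ?thesis unfolding summand sum_distrib_left[symmetric] by simp
    qed
    ultimately have lim: "((\<lambda>s. (covariance M (Y i t) (Y j (t + s))
                   - \<nu> 1 * \<nu> 2 * (\<rho> + \<eta> j i) / (2 * (\<alpha> 1 + \<alpha> 2)) *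
                     (\<Sum>n=0..N. ((- 1) ^ n / \<alpha> j ^ (n + 1) + 1 / \<alpha> i ^ (n + 1)) *
                        (\<Prod>k=0..n+1. (h - real k)) * s powr (h - 2 - real n)))
                  / s powr (h - real N - 3))
      \<longlongrightarrow> \<nu> 1 * \<nu> 2 * (\<kappa> * (1 / \<alpha> i ^ (N + 2) - (- 1) ^ N / \<alpha> j ^ (N + 2)) / (\<alpha> 1 + \<alpha> 2))) at_top"
      by (simp only:)
    have \<kappa>: "\<kappa> \<noteq> 0" if "\<rho> + \<eta> j i \<noteq> 0"
    proof -
      \<comment> \<open>As 0 < h < 2 and h \<noteq> 1, h is not a natural number, so no factor of
        the product vanishes.\<close>
      have "h \<noteq> real k" for k
      proof
        assume "h = real k"
        with h have "k = 1" by auto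
        with \<open>h = real k\<close> h1 show False by simp
      qed
      with that show ?thesis by (simp add: \<kappa>_def)
    qed
    show "\<exists>C.
            ((\<lambda>s. (covariance M (Y i t) (Y j (t + s))
                   - \<nu> 1 * \<nu> 2 * (\<rho> + \<eta> j i) / (2 * (\<alpha> 1 + \<alpha> 2)) *
                     (\<Sum>n=0..N. ((- 1) ^ n / \<alpha> j ^ (n + 1) + 1 / \<alpha> i ^ (n + 1)) *
                        (\<Prod>k=0..n+1. (h - real k)) * s powr (h - 2 - real n)))
                  / s powr (h - real N - 3)) \<longlongrightarrow> C) at_top \<and>
            (\<rho> + \<eta> j i \<noteq> 0 \<and> (\<alpha> i \<noteq> \<alpha> j \<or> odd N) \<longrightarrow> C \<noteq> 0)"
      by (intro exI conjI impI, rule lim) (use C \<kappa> in blast)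
  next
    assume h1: "h = 1"
    define G where "G = log_kernel (\<rho> / 2) (\<eta> i j / 2)"
    define g where "g = log_deriv (\<rho> / 2) (\<eta> i j / 2)"
    define \<kappa> where "\<kappa> = \<eta> i j / 2 * (\<Prod>k<N+1. - real k - 1)"
    define c where "c n = (- 1) ^ n / \<alpha> j ^ (n + 1) + 1 / \<alpha> i ^ (n + 1)" for n :: nat
    have g2: "g (n + 2) s = \<eta> i j / 2 * (\<Prod>k<n. - real k - 1) * s powr (- 1 - real n)" for n s
      by (simp add: g_def)
    have "((\<lambda>s. (covariance M (Y i t) (Y j (t + s))
              - \<nu> 1 * \<nu> 2 * (\<Sum>n=0..N. ((- 1) ^ n / \<alpha> j ^ (n + 1) + 1 / \<alpha> i ^ (n + 1)) / (\<alpha> 1 + \<alpha> 2) * g (n + 2) s))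
             / s powr (- real N - 2))
      \<longlongrightarrow> \<nu> 1 * \<nu> 2 * (\<kappa> * (1 / \<alpha> i ^ (N + 2) - (- 1) ^ N / \<alpha> j ^ (N + 2)) / (\<alpha> 1 + \<alpha> 2))) at_top"
    proof (rule expansion[unfolded h1, OF fbm_cross_cov_log_kernel, folded G_def])
      show "G x = g 0 x" if "x > 0" for x
        using that by (simp add: G_def g_def log_kernel_def)
      show "g (N + 3) x = \<kappa> * x powr (- real N - 2)" for x
      proof -
        have "N + 3 = (N + 1) + 2" "- 1 - real (N + 1) = - real N - 2" by simp_all
        then show ?thesis by (simp only: g2 \<kappa>_def)
      qed
    qed (use pos in \<open>auto simp: G_def g_def intro!: continuous_on_log_kernel quad_bounded_log_kernel
          DERIV_log_deriv exp_log_deriv_tendsto_0[of "\<alpha> i", simplified]\<close>)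
    moreover have "\<forall>\<^sub>F s in at_top.
        (covariance M (Y i t) (Y j (t + s))
              - \<nu> 1 * \<nu> 2 * (\<Sum>n=0..N. ((- 1) ^ n / \<alpha> j ^ (n + 1) + 1 / \<alpha> i ^ (n + 1)) / (\<alpha> 1 + \<alpha> 2) * g (n + 2) s))
             / s powr (- real N - 2)
        = (covariance M (Y i t) (Y j (t + s))
                   - \<nu> 1 * \<nu> 2 * \<eta> i j / (2 * \<alpha> 1 * \<alpha> 2) * (1 / s)
                   - \<nu> 1 * \<nu> 2 * \<eta> i j / (2 * (\<alpha> 1 + \<alpha> 2)) *
                     (\<Sum>n=1..N. ((- 1) ^ n / \<alpha> j ^ (n + 1) + 1 / \<alpha> i ^ (n + 1)) *
                        (\<Prod>k=0..n-1. (- real k - 1)) * s powr (- 1 - real n)))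
                  / s powr (- real N - 2)"
      using eventually_gt_at_top[of 0]
    proof eventually_elim
      case (elim s)
      \<comment> \<open>The summand n = 0 simplifies because 1 / \<alpha> 1 + 1 / \<alpha> 2 =
        (\<alpha> 1 + \<alpha> 2) / (\<alpha> 1 \<alpha> 2); it becomes the separate 1 / s
        term.\<close>
      have "c 0 / (\<alpha> 1 + \<alpha> 2) = 1 / (\<alpha> 1 * \<alpha> 2)"
      proof -
        have "c 0 = 1 / \<alpha> 1 + 1 / \<alpha> 2" using assms(7-9) by (auto simp: c_def)
        also have "\<dots> = (\<alpha> 1 + \<alpha> 2) / (\<alpha> 1 * \<alpha> 2)" using pos by (simp add: add_divide_eq_iff divide_add_eq_iff)
        finally show ?thesis using pos by simp
      qed
      then have first: "c 0 / (\<alpha> 1 + \<alpha> 2) * g (0 + 2) s = \<eta> i j / (2 * \<alpha> 1 * \<alpha> 2) * (1 / s)"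
        unfolding g2 using elim by (simp add: powr_minus_divide)
      have rest: "c n / (\<alpha> 1 + \<alpha> 2) * g (n + 2) s
          = \<eta> i j / (2 * (\<alpha> 1 + \<alpha> 2)) * (c n * (\<Prod>k=0..n-1. (- real k - 1)) * s powr (- 1 - real n))"
        if "n \<in> {1..N}" for n
      proof -
        \<comment> \<open>This needs n \<ge> 1: at n = 0 truncated subtraction would leave the index
          0 in a product that ought to be empty.\<close>
        have "{0..n-1} = {..<n}" using that by auto
        then show ?thesis by (simp only: g2 frac)
      qed
      have "(\<Sum>n=0..N. c n / (\<alpha> 1 + \<alpha> 2) * g (n + 2) s)
          = c 0 / (\<alpha> 1 + \<alpha> 2) * g (0 + 2) s + (\<Sum>n=1..N. c n / (\<alpha> 1 + \<alpha> 2) * g (n + 2) s)"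
        by (simp add: sum.atLeast_Suc_atMost)
      also have "\<dots> = \<eta> i j / (2 * \<alpha> 1 * \<alpha> 2) * (1 / s) + \<eta> i j / (2 * (\<alpha> 1 + \<alpha> 2)) *
          (\<Sum>n=1..N. c n * (\<Prod>k=0..n-1. (- real k - 1)) * s powr (- 1 - real n))"
        by (simp only: first sum_distrib_left sum.cong[OF refl rest])
      finally have "\<nu> 1 * \<nu> 2 * (\<Sum>n=0..N. c n / (\<alpha> 1 + \<alpha> 2) * g (n + 2) s)
          = \<nu> 1 * \<nu> 2 * \<eta> i j / (2 * \<alpha> 1 * \<alpha> 2) * (1 / s) + \<nu> 1 * \<nu> 2 * \<eta> i j / (2 * (\<alpha> 1 + \<alpha> 2)) *
          (\<Sum>n=1..N. c n * (\<Prod>k=0..n-1. (- real k - 1)) * s powr (- 1 - real n))"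
        by (simp only: distrib_left mult.assoc times_divide_eq_right times_divide_eq_left)
      then show ?case unfolding c_def by (simp only: diff_diff_eq)
    qed
    ultimately have lim: "((\<lambda>s. (covariance M (Y i t) (Y j (t + s))
                   - \<nu> 1 * \<nu> 2 * \<eta> i j / (2 * \<alpha> 1 * \<alpha> 2) * (1 / s)
                   - \<nu> 1 * \<nu> 2 * \<eta> i j / (2 * (\<alpha> 1 + \<alpha> 2)) *
                     (\<Sum>n=1..N. ((- 1) ^ n / \<alpha> j ^ (n + 1) + 1 / \<alpha> i ^ (n + 1)) *
                        (\<Prod>k=0..n-1. (- real k - 1)) * s powr (- 1 - real n)))
                  / s powr (- real N - 2))
       \<longlongrightarrow> \<nu> 1 * \<nu> 2 * (\<kappa> * (1 / \<alpha> i ^ (N + 2) - (- 1) ^ N / \<alpha> j ^ (N + 2)) / (\<alpha> 1 + \<alpha> 2))) at_top"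
      by (rule Lim_transform_eventually)
    have \<kappa>: "\<kappa> \<noteq> 0" if "\<eta> i j \<noteq> 0"
    proof -
      have "- real k - 1 \<noteq> 0" for k by simp
      with that show ?thesis by (simp add: \<kappa>_def)
    qed
    show "\<exists>C.
            ((\<lambda>s. (covariance M (Y i t) (Y j (t + s))
                   - \<nu> 1 * \<nu> 2 * \<eta> i j / (2 * \<alpha> 1 * \<alpha> 2) * (1 / s)
                   - \<nu> 1 * \<nu> 2 * \<eta> i j / (2 * (\<alpha> 1 + \<alpha> 2)) *
                     (\<Sum>n=1..N. ((- 1) ^ n / \<alpha> j ^ (n + 1) + 1 / \<alpha> i ^ (n + 1)) *
                        (\<Prod>k=0..n-1. (- real k - 1)) * s powr (- 1 - real n)))
                  / s powr (- real N - 2)) \<longlongrightarrow> C) at_top \<and>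
            (\<eta> i j \<noteq> 0 \<and> (\<alpha> i \<noteq> \<alpha> j \<or> odd N) \<longrightarrow> C \<noteq> 0)"
      by (intro exI conjI impI, rule lim) (use C \<kappa> in blast)
  qed
qed

end
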